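(* Consider the aggregative game with players $\mathcal N=\{1,\dots,N\}$, strategy sets $K_i\subset\mathbb R^n$ and cost functions $f_i$, with the maps $F_i$, $\phi$, the sets $K=\prod_iK_i$, $\bar K=\sum_iK_i$, and the asynchronous gossip algorithm, all as defined in the context. Assume: (1) each $K_i$ is nonempty, compact and convex; each $f_i(x_i,u)$ is continuously differentiable in $(x_i,u)$ over some open set containing $K_i\times\bar K$; and each function $x_i\mapsto f_i(x_i,\bar x)$, with $\bar x=x_i+\sum_{j\ne i}x_j$, is convex over $K_i$; (2) $\phi$ is strictly monotone over $K$: $(\phi(x)-\phi(x'))^T(x-x')>0$ for all $x,x'\in K$ with $x\neq x'$; (3) each $F_i(x_i,u)$ is uniformly Lipschitz continuous in $u$ over $\bar K$ for every fixed $x_i\in K_i$: for some $\bar L_i>0$, $\|F_i(x_i,z_1)-F_i(x_i,z_2)\|\le\bar L_i\|z_1-z_2\|$ for all $x_i\in K_i$ and all $z_1,z_2\in\bar K$; (4) the undirected graph $\mathcal G(\mathcal N,\mathcal E)$ is connected. Then the sequence $x^k=(x^k_1,\dots,x^k_N)$ generated by the gossip algorithm with stepsizes $\alpha_{k,i}=1/\Gamma_k(i)$, where $\Gamma_k(i)$ is the number of updates agent $i$ has executed up to and including time $k$, converges almost surely to the unique Nash equilibrium $x^*$ of the game.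
   Context: Game: given $\bar x_{-i}=\sum_{j\ne i}x_j$, player $i$ minimizes $f_i(x_i,x_i+\bar x_{-i})$ over $x_i\in K_i$; a Nash equilibrium is $x^*\in K$ such that each $x_i^*$ solves player $i$'s problem given $\bar x_{-i}^*$. Notation: $\bar x=\sum_{j}x_j$; $\bar K=\sum_{i}K_i$ (Minkowski sum); $K=\prod_iK_i$; $F_i(x_i,\bar x)=\nabla_{x_i}f_i(x_i,\bar x)$ is the gradient with respect to $x_i$ of $x_i\mapsto f_i(x_i,x_i+\bar x_{-i})$, i.e. $F_i(x_i,u)=\nabla_1f_i(x_i,u)+\nabla_2f_i(x_i,u)$; $\phi(x)=(F_1(x_1,\bar x)^T,\dots,F_N(x_N,\bar x)^T)^T$. $\Pi_{K_i}$ is Euclidean projection onto $K_i$; $\|\cdot\|$ is the Euclidean norm. Gossip model: $\mathcal G(\mathcal N,\mathcal E)$ is a fixed undirected graph without self-loops on $N\ge 2$ nodes, $\mathcal N_i=\{j:\{i,j\}\in\mathcal E\}$. At each discrete time $k$ an agent $I^k$ is chosen uniformly at random from $\mathcal N$ and, given $I^k=i$, contacts a neighbor $J^k=j\in\mathcal N_i$ with probability $p_{ij}>0$, $\sum_{j\in\mathcal N_i}p_{ij}=1$; the pairs $(I^k,J^k)$ are independent over $k$ and independent of the initial decisions. Agent $i$ "updates at time $k$" when $i\in\{I^k,J^k\}$. Gossip algorithm: start from (random) $x_i^0\in K_i$, $v_i^0=x_i^0$. At time $k$, for $i\in\{I^k,J^k\}$, $$\hat v_i^k=\tfrac12(v^k_{I^k}+v^k_{J^k}),\quad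 x_i^{k+1}=\Pi_{K_i}[x_i^k-\alpha_{k,i}F_i(x_i^k,N\hat v_i^k)],\quad v_i^{k+1}=\hat v_i^k+x_i^{k+1}-x_i^k,$$ and for $i\notin\{I^k,J^k\}$: $\hat v_i^k=v_i^k$, $x_i^{k+1}=x_i^k$, $v_i^{k+1}=v_i^k$.
   Formalization: As N v̂_i^k can leave K̄, where F_i need not be defined, F_i is taken to be any total map that equals the gradient on the open set containing K_i×K̄ and, as an added assumption, is bounded on K_i×B for every bounded B. *)

theory Defs
  imports "HOL-Probability.Probability"
begin

section \<open>The aggregative game\<close>

text \<open>
  Players are the elements of a finite type \<open>'p\<close>, so \<open>N = CARD('p)\<close>, and a profile is an element
  of \<open>real ^ 'n ^ 'p\<close>, the Euclidean space with the stacked inner product and norm.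
\<close>

definition profiles :: "('p::finite \<Rightarrow> (real ^ 'n) set) \<Rightarrow> (real ^ 'n ^ 'p) set" where
  "profiles K = {x. \<forall>i. x $ i \<in> K i}"

definition aggregate :: "real ^ 'n ^ 'p::finite \<Rightarrow> real ^ 'n" where
  "aggregate x = (\<Sum>i\<in>UNIV. x $ i)"

definition aggregate_others :: "'p \<Rightarrow> real ^ 'n ^ 'p::finite \<Rightarrow> real ^ 'n" where
  "aggregate_others i x = (\<Sum>j\<in>UNIV - {i}. x $ j)"

text \<open>The Minkowski sum of the strategy sets.\<close>

definition aggregates :: "('p::finite \<Rightarrow> (real ^ 'n) set) \<Rightarrow> (real ^ 'n) set" where
  "aggregates K = aggregate ` profiles K"

definition nash_equilibrium ::
    "('p::finite \<Rightarrow> (real ^ 'n) set) \<Rightarrow>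
     ('p \<Rightarrow> real ^ 'n \<Rightarrow> real ^ 'n \<Rightarrow> real) \<Rightarrow> real ^ 'n ^ 'p \<Rightarrow> bool" where
  "nash_equilibrium K f x \<longleftrightarrow>
     x \<in> profiles K \<and>
     (\<forall>i. \<forall>z\<in>K i. f i (x $ i) (x $ i + aggregate_others i x) \<le> f i z (z + aggregate_others i x))"

section \<open>Gradients\<close>

definition grad :: "('a::real_inner \<Rightarrow> real) \<Rightarrow> 'a \<Rightarrow> 'a" where
  "grad g x = (THE D. GDERIV g x :> D)"

definition continuously_differentiable_over :: "'a::real_inner set \<Rightarrow> ('a \<Rightarrow> real) \<Rightarrow> bool" where
  "continuously_differentiable_over S g \<longleftrightarrow>
     (\<exists>D. (\<forall>z\<in>S. GDERIV g z :> D z) \<and> continuous_on S D)"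

text \<open>
  The sum of the two partial gradients of \<open>g\<close>; by \<open>GDERIV_along_aggregate\<close> below it is the gradient
  of \<open>z \<mapsto> g z (z + s)\<close> at \<open>x\<close>, taken at \<open>u = x + s\<close>.
\<close>

definition aggregative_grad :: "('a::real_inner \<Rightarrow> 'a \<Rightarrow> real) \<Rightarrow> 'a \<Rightarrow> 'a \<Rightarrow> 'a" where
  "aggregative_grad g x u = grad (\<lambda>z. g z u) x + grad (\<lambda>w. g x w) u"

lemma grad_eqI:
  assumes "GDERIV g x :> D"
  shows "grad g x = D"
  unfolding grad_def
proof (rule the_equality)
  fix D' assume "GDERIV g x :> D'"
  then have "(\<lambda>h. inner h D') = (\<lambda>h. inner h D)"
    using assms unfolding gderiv_def by (rule has_derivative_unique)
  then have "inner (D' - D) D' = inner (D' - D) D"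
    by (rule fun_cong)
  then have "inner (D' - D) (D' - D) = 0"
    by (simp add: inner_diff_right)
  then show "D' = D"
    by simp
qed (rule assms)

lemma GDERIV_along_aggregate:
  assumes "GDERIV (\<lambda>(z, w). g z w) (x, x + s) :> D"
  shows "GDERIV (\<lambda>z. g z (z + s)) x :> aggregative_grad g x (x + s)"
proof -
  have D: "((\<lambda>(z, w). g z w) has_derivative (\<lambda>h. inner h D)) (at (x, x + s))"
    using assms by (simp add: gderiv_def)
  have "((\<lambda>z. (z, x + s)) has_derivative (\<lambda>h. (h, 0))) (at x)"
    by (auto intro!: derivative_eq_intros)
  from has_derivative_compose[OF this, where g = "\<lambda>(z, w). g z w"] D
  have 1: "((\<lambda>z. g z (x + s)) has_derivative (\<lambda>h. inner (h, 0) D)) (at x)"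
    by simp
  have "((\<lambda>w. (x, w)) has_derivative (\<lambda>h. (0, h))) (at (x + s))"
    by (auto intro!: derivative_eq_intros)
  from has_derivative_compose[OF this, where g = "\<lambda>(z, w). g z w"] D
  have 2: "((\<lambda>w. g x w) has_derivative (\<lambda>h. inner (0, h) D)) (at (x + s))"
    by simp
  have "((\<lambda>z. (z, z + s)) has_derivative (\<lambda>h. (h, h))) (at x)"
    by (auto intro!: derivative_eq_intros)
  from has_derivative_compose[OF this, where g = "\<lambda>(z, w). g z w"] D
  have 3: "((\<lambda>z. g z (z + s)) has_derivative (\<lambda>h. inner (h, h) D)) (at x)"
    by simp
  have "grad (\<lambda>z. g z (x + s)) x = fst D"
    using 1 by (intro grad_eqI) (simp add: gderiv_def inner_prod_def)
  moreover have "grad (\<lambda>w. g x w) (x + s) = snd D"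
    using 2 by (intro grad_eqI) (simp add: gderiv_def inner_prod_def)
  ultimately show ?thesis
    using 3 by (simp add: gderiv_def aggregative_grad_def inner_prod_def inner_add_right)
qed

text \<open>The stacked gradient map \<open>\<phi>\<close>.\<close>

definition game_map ::
    "('p::finite \<Rightarrow> real ^ 'n \<Rightarrow> real ^ 'n \<Rightarrow> real ^ 'n) \<Rightarrow> real ^ 'n ^ 'p \<Rightarrow> real ^ 'n ^ 'p" where
  "game_map F x = (\<chi> i. F i (x $ i) (aggregate x))"

section \<open>The communication graph\<close>

definition neighbours :: "'p set set \<Rightarrow> 'p \<Rightarrow> 'p set" where
  "neighbours E i = {j. {i, j} \<in> E}"

definition connected_graph :: "'p set set \<Rightarrow> bool" where
  "connected_graph E \<longleftrightarrow> (\<forall>i j. (i, j) \<in> {(a, b). {a, b} \<in> E}\<^sup>*)"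

section \<open>The gossip algorithm\<close>

text \<open>
  A contact sequence \<open>c\<close> gives the pair \<open>c k\<close> of agents that are active at time \<open>k\<close>.
\<close>

definition active :: "(nat \<Rightarrow> 'p \<times> 'p) \<Rightarrow> nat \<Rightarrow> 'p set" where
  "active c k = {fst (c k), snd (c k)}"

definition updates :: "(nat \<Rightarrow> 'p \<times> 'p) \<Rightarrow> nat \<Rightarrow> 'p \<Rightarrow> nat" where
  "updates c k i = card {t. t \<le> k \<and> i \<in> active c t}"

definition mixed :: "(nat \<Rightarrow> 'p \<times> 'p) \<Rightarrow> nat \<Rightarrow> real ^ 'n ^ 'p::finite \<Rightarrow> 'p \<Rightarrow> real ^ 'n" where
  "mixed c k v i =
     (if i \<in> active c k then (1 / 2) *\<^sub>R (v $ fst (c k) + v $ snd (c k)) else v $ i)"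

text \<open>
  The state is the pair of the decisions \<open>x\<close> and the estimates \<open>v\<close>. The argument \<open>N *\<^sub>R mixed c k v i\<close>
  need not be an attainable aggregate, so the algorithm also evaluates \<open>F i\<close> outside
  \<open>K i \<times> aggregates K\<close>. For this reason \<open>F\<close> is a parameter and not a function of the costs:
  it is a total extension of the gradient maps, which the costs determine only
  where they are known to be differentiable.
\<close>

primrec gossip ::
    "('p::finite \<Rightarrow> (real ^ 'n) set) \<Rightarrow> ('p \<Rightarrow> real ^ 'n \<Rightarrow> real ^ 'n \<Rightarrow> real ^ 'n) \<Rightarrow>
     (nat \<Rightarrow> 'p \<times> 'p) \<Rightarrow> (nat \<Rightarrow> 'p \<Rightarrow> real) \<Rightarrow> real ^ 'n ^ 'p \<Rightarrow> nat \<Rightarrow>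
     (real ^ 'n ^ 'p) \<times> (real ^ 'n ^ 'p)" where
  "gossip K F c \<alpha> x0 0 = (x0, x0)"
| "gossip K F c \<alpha> x0 (Suc k) =
     (let (x, v) = gossip K F c \<alpha> x0 k;
          x' = (\<chi> i. if i \<in> active c k
                  then closest_point (K i)
                         (x $ i - \<alpha> k i *\<^sub>R F i (x $ i) (real CARD('p) *\<^sub>R mixed c k v i))
                  else x $ i);
          v' = (\<chi> i. if i \<in> active c k then mixed c k v i + x' $ i - x $ i else v $ i)
      in (x', v'))"

definition gossip_decisions ::
    "('p::finite \<Rightarrow> (real ^ 'n) set) \<Rightarrow> ('p \<Rightarrow> real ^ 'n \<Rightarrow> real ^ 'n \<Rightarrow> real ^ 'n) \<Rightarrow>
     (nat \<Rightarrow> 'p \<times> 'p) \<Rightarrow> (nat \<Rightarrow> 'p \<Rightarrow> real) \<Rightarrow> real ^ 'n ^ 'p \<Rightarrow> nat \<Rightarrow> real ^ 'n ^ 'p" where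
  "gossip_decisions K F c \<alpha> x0 k = fst (gossip K F c \<alpha> x0 k)"

text \<open>
  The random contacts \<open>(I k, J k)\<close>: the initiator is uniform, and \<open>p i j\<close> is the probability
  that initiator \<open>i\<close> contacts its neighbour \<open>j\<close>. Values of \<open>p\<close> off the edges are irrelevant.
\<close>

definition gossip_contacts ::
    "'w measure \<Rightarrow> 'p::finite set set \<Rightarrow> ('p \<Rightarrow> 'p \<Rightarrow> real) \<Rightarrow>
     (nat \<Rightarrow> 'w \<Rightarrow> 'p) \<Rightarrow> (nat \<Rightarrow> 'w \<Rightarrow> 'p) \<Rightarrow> bool" where
  "gossip_contacts M E p I J \<longleftrightarrow>
     (\<forall>i. \<forall>j\<in>neighbours E i. p i j > 0) \<and>
     (\<forall>i. (\<Sum>j\<in>neighbours E i. p i j) = 1) \<and>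
     prob_space.indep_vars M (\<lambda>_. count_space UNIV) (\<lambda>k \<omega>. (I k \<omega>, J k \<omega>)) UNIV \<and>
     (\<forall>k i. \<P>(\<omega> in M. I k \<omega> = i) = 1 / real CARD('p)) \<and>
     (\<forall>k i. \<forall>j\<in>neighbours E i. \<P>(\<omega> in M. J k \<omega> = j \<bar> I k \<omega> = i) = p i j)"

end

theory Submission
  imports Defs
begin

text \<open>
  Only two facts about the random contacts matter, and both hold almost surely by the strong law
  of large numbers: every agent \<open>i\<close> is active with an asymptotic frequency \<open>\<pi> i > 0\<close>, and a fixed
  word \<open>w\<close> that lists all edges of the graph occurs with a positive frequency among the blocks of
  \<open>length w\<close> consecutive contacts. From there on the argument is deterministic.

  Averaging along \<open>w\<close> contracts the disagreement of the estimates by a fixed factor. The frequencies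
  make the steps \<open>O(1/k)\<close>, and in every window \<open>{n / (1 + r)..<n}\<close> the word occurs for large \<open>n\<close>,
  so the disagreement tends to zero. As \<open>F i\<close> is continuous near the
  compact set \<open>K i \<times> aggregates K\<close>, the directions used by the agents approach the game map.

  In the same window agent \<open>i\<close> uses the steps \<open>1/m\<close> for consecutive \<open>m\<close>, from about \<open>\<pi> i n / (1 + r)\<close>
  to \<open>\<pi> i n\<close>. Their sum tends to \<open>ln (1 + r)\<close>, whatever \<open>\<pi> i\<close> is, so over a window the
  algorithm acts like one projected gradient step of length \<open>ln (1 + r)\<close> for all agents together, and
  strict monotonicity decreases the distance to the equilibrium.
\<close>

section \<open>Frequencies in independent trials\<close>

text \<open>Hoeffding's inequality bounds the probability of a deviation by
  \<open>\<epsilon>\<close> after \<open>n\<close> trials by a geometric term, so Borel-Cantelli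
  leaves only finitely many deviations for each tolerance.\<close>

lemma (in prob_space) frequency_tendsto_AE:
  fixes X :: "nat \<Rightarrow> 'a \<Rightarrow> real"
  assumes indep: "indep_vars (\<lambda>_. borel) X UNIV"
    and range: "\<And>n \<omega>. \<omega> \<in> space M \<Longrightarrow> X n \<omega> \<in> {0..1}"
    and mean: "\<And>n. expectation (X n) = q"
  shows "AE \<omega> in M. (\<lambda>n. (\<Sum>t<n. X t \<omega>) / real n) \<longlonglongrightarrow> q"
proof -
  have [measurable]: "X n \<in> borel_measurable M" for n
    using indep unfolding indep_vars_def by blast
  have close: "AE \<omega> in M. eventually (\<lambda>n. \<bar>(\<Sum>t<n. X t \<omega>) / real n - q\<bar> < \<epsilon>) sequentially"
    if "\<epsilon> > 0" for \<epsilon> :: real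
  proof -
    define A where "A n = {\<omega> \<in> space M. \<bar>(\<Sum>t<n. X t \<omega>) - real n * q\<bar> \<ge> real n * \<epsilon>}" for n
    \<comment> \<open>The Hoeffding exponent for the deviation \<open>n * \<epsilon>\<close> is
      linear in \<open>n\<close>; \<open>r\<close> is the factor contributed by each trial.\<close>
    define r where "r = exp (- 2 * \<epsilon>\<^sup>2)"
    have r: "0 < r" "r < 1"
      using that by (auto simp: r_def)
    have A_le: "prob (A n) \<le> 2 * r ^ n" for n
    proof (cases "n = 0")
      case True
      then show ?thesis
        by (simp add: A_def) (rule order_trans[OF prob_le_1], simp)
    next
      case False
      have "indep_vars (\<lambda>_. borel) X {..<n}"
        by (rule indep_vars_subset[OF indep]) simp
      then interpret Hoeffding_ineq M "{..<n}" X "\<lambda>_. 0" "\<lambda>_. 1" "real n * q"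
        using range mean by unfold_locales (auto simp: mean)
      have "prob (A n) \<le> 2 * exp (- 2 * (real n * \<epsilon>)\<^sup>2 / real n)"
        using Hoeffding_ineq_abs_ge[of "real n * \<epsilon>"] False that by (simp add: A_def)
      also have "- 2 * (real n * \<epsilon>)\<^sup>2 / real n = real n * (- 2 * \<epsilon>\<^sup>2)"
        using False by (simp add: power2_eq_square)
      finally show ?thesis
        by (simp only: r_def exp_of_nat_mult)
    qed
    have "summable (\<lambda>n. 2 * r ^ n)"
      using r by (intro summable_mult summable_geometric) auto
    then have "summable (\<lambda>n. measure M (A n))"
      by (rule summable_comparison_test_ev[rotated]) (use A_le in auto)
    then have "AE \<omega> in M. eventually (\<lambda>n. \<omega> \<in> space M - A n) sequentially"
      by (intro borel_cantelli_AE1) (auto simp: A_def less_top[symmetric])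
    then show ?thesis
    proof (rule AE_mp, intro AE_I2 impI)
      fix \<omega> assume "\<omega> \<in> space M" "eventually (\<lambda>n. \<omega> \<in> space M - A n) sequentially"
      from this(2) eventually_gt_at_top[of 0]
      show "eventually (\<lambda>n. \<bar>(\<Sum>t<n. X t \<omega>) / real n - q\<bar> < \<epsilon>) sequentially"
      proof eventually_elim
        case (elim n)
        then have "\<bar>(\<Sum>t<n. X t \<omega>) - real n * q\<bar> < real n * \<epsilon>"
          by (auto simp: A_def)
        moreover have "(\<Sum>t<n. X t \<omega>) / real n - q = ((\<Sum>t<n. X t \<omega>) - real n * q) / real n"
          using elim by (simp add: field_simps)
        ultimately show ?case
          using elim by (simp add: abs_divide field_simps)
      qed
    qed
  qed
  \<comment> \<open>Only countably many null sets may be united, so the tolerances run through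
    \<open>1 / Suc m\<close>.\<close>
  have "AE \<omega> in M. \<forall>m::nat. eventually (\<lambda>n. \<bar>(\<Sum>t<n. X t \<omega>) / real n - q\<bar> < 1 / real (Suc m)) sequentially"
    by (subst AE_all_countable) (use close in auto)
  then show ?thesis
  proof (rule AE_mp, intro AE_I2 impI)
    fix \<omega> assume *: "\<forall>m::nat. eventually (\<lambda>n. \<bar>(\<Sum>t<n. X t \<omega>) / real n - q\<bar> < 1 / real (Suc m)) sequentially"
    show "(\<lambda>n. (\<Sum>t<n. X t \<omega>) / real n) \<longlonglongrightarrow> q"
    proof (rule tendstoI)
      fix \<epsilon> :: real assume "\<epsilon> > 0"
      then obtain m where "1 / real (Suc m) < \<epsilon>"
        by (metis nat_approx_posE)
      with *[rule_format, of m]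
      show "eventually (\<lambda>n. dist ((\<Sum>t<n. X t \<omega>) / real n) q < \<epsilon>) sequentially"
        by (auto simp: dist_real_def elim!: eventually_mono)
    qed
  qed
qed

lemma (in prob_space) letter_frequency_AE:
  fixes X :: "nat \<Rightarrow> 'a \<Rightarrow> 'b::finite"
  assumes indep: "indep_vars (\<lambda>_. count_space UNIV) X UNIV"
    and law: "\<And>n. prob {\<omega> \<in> space M. X n \<omega> \<in> B} = q"
  shows "AE \<omega> in M. (\<lambda>n. (\<Sum>t<n. of_bool (X t \<omega> \<in> B)) / real n) \<longlonglongrightarrow> q"
proof (rule frequency_tendsto_AE)
  have [measurable]: "X n \<in> measurable M (count_space UNIV)" for n
    using indep unfolding indep_vars_def by blast
  show "indep_vars (\<lambda>_. borel) (\<lambda>n \<omega>. of_bool (X n \<omega> \<in> B) :: real) UNIV"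
    by (rule indep_vars_compose2[OF indep]) auto
  fix n
  have "expectation (\<lambda>\<omega>. of_bool (X n \<omega> \<in> B)) = expectation (indicator {\<omega> \<in> space M. X n \<omega> \<in> B})"
    by (rule Bochner_Integration.integral_cong) (auto simp: indicator_def)
  also have "\<dots> = prob {\<omega> \<in> space M. X n \<omega> \<in> B}"
    by (subst Bochner_Integration.integral_indicator) (auto intro!: arg_cong[where f = prob])
  finally show "expectation (\<lambda>\<omega>. of_bool (X n \<omega> \<in> B)) = q"
    by (simp only: law)
qed auto

text \<open>\<open>n\<close> numbers blocks, not positions: only aligned occurrences count, so that
  different \<open>n\<close> read disjoint stretches of the sequence.\<close>

definition word_at :: "(nat \<Rightarrow> 'b) \<Rightarrow> 'b list \<Rightarrow> nat \<Rightarrow> bool" where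
  "word_at c w n \<longleftrightarrow> (\<forall>t<length w. c (n * length w + t) = w ! t)"

text \<open>Disjoint blocks of independent trials are independent, so the occurrences of
  \<open>w\<close> in successive blocks are again independent trials. Their common mean is the
  product of the letter probabilities.\<close>

lemma (in prob_space) word_frequency_AE:
  fixes X :: "nat \<Rightarrow> 'a \<Rightarrow> 'b::finite"
  assumes indep: "indep_vars (\<lambda>_. count_space UNIV) X UNIV"
    and law: "\<And>n b. b \<in> set w \<Longrightarrow> prob {\<omega> \<in> space M. X n \<omega> = b} = \<mu> b"
    and w: "w \<noteq> []"
  shows "AE \<omega> in M. (\<lambda>n. (\<Sum>t<n. of_bool (word_at (\<lambda>s. X s \<omega>) w t)) / real n)
    \<longlonglongrightarrow> (\<Prod>t<length w. \<mu> (w ! t))"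
proof (rule frequency_tendsto_AE)
  define L where "L n = {n * length w ..< n * length w + length w}" for n
  have [measurable]: "X n \<in> measurable M (count_space UNIV)" for n
    using indep unfolding indep_vars_def by blast
  have mono: "n * length w + length w \<le> m * length w" if "n < m" for n m
  proof -
    have "Suc n * length w \<le> m * length w"
      using that by (intro mult_right_mono) auto
    then show ?thesis
      by (simp add: add.commute)
  qed
  have disj: "disjoint_family_on L UNIV"
    unfolding disjoint_family_on_def
  proof (intro ballI impI)
    fix m n :: nat assume "m \<noteq> n"
    then show "L m \<inter> L n = {}"
      using mono[of m n] mono[of n m] by (cases m n rule: linorder_cases) (auto simp: L_def)
  qed
  have restricted: "indep_vars (\<lambda>n. PiM (L n) (\<lambda>_. count_space UNIV)) (\<lambda>n \<omega>. restrict (\<lambda>s. X s \<omega>) (L n)) UNIV"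
    using w by (intro indep_vars_restrict[OF indep] disj) (auto simp: L_def)
  \<comment> \<open>Restricting to \<open>L n\<close> does not affect \<open>word_at\<close>, and it
    exhibits the indicator as a measurable function of the block alone.\<close>
  have "indep_vars (\<lambda>_. borel) (\<lambda>n \<omega>. of_bool (word_at (restrict (\<lambda>s. X s \<omega>) (L n)) w n) :: real) UNIV"
  proof (rule indep_vars_compose2[OF restricted, where Y = "\<lambda>n g. of_bool (word_at g w n) :: real"])
    fix n
    have [measurable]: "(\<lambda>g. g (n * length w + t)) \<in>
        measurable (PiM (L n) (\<lambda>_. count_space UNIV)) (count_space (UNIV :: 'b set))"
      if "t < length w" for t
      using that by (intro measurable_component_singleton) (auto simp: L_def)
    have "Measurable.pred (PiM (L n) (\<lambda>_. count_space UNIV)) (\<lambda>g. \<forall>t\<in>{..<length w}. g (n * length w + t) = w ! t)"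
      by measurable
    then show "(\<lambda>g. of_bool (word_at g w n) :: real) \<in>
        borel_measurable (PiM (L n) (\<lambda>_. count_space UNIV))"
      unfolding word_at_def by (intro measurable_compose[OF _ measurable_of_bool]) simp
  qed
  then show "indep_vars (\<lambda>_. borel) (\<lambda>n \<omega>. of_bool (word_at (\<lambda>s. X s \<omega>) w n) :: real) UNIV"
    by (simp add: word_at_def L_def)
  fix n
  have "{\<omega> \<in> space M. word_at (\<lambda>s. X s \<omega>) w n} =
      (\<Inter>s\<in>L n. X s -` {w ! (s - n * length w)} \<inter> space M)" (is "?A = ?B")
  proof (intro equalityI subsetI)
    fix \<omega> assume A: "\<omega> \<in> ?A"
    have "X s \<omega> = w ! (s - n * length w)" if "s \<in> L n" for s
    proof -
      from that have "s = n * length w + (s - n * length w)" "s - n * length w < length w"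
        by (auto simp: L_def)
      with A show ?thesis
        unfolding word_at_def by (metis (mono_tags, lifting) mem_Collect_eq)
    qed
    with A show "\<omega> \<in> ?B"
      by auto
  next
    fix \<omega> assume B: "\<omega> \<in> ?B"
    have "X (n * length w + t) \<omega> = w ! t" if "t < length w" for t
      using B[THEN INT_D, of "n * length w + t"] that by (auto simp: L_def)
    moreover have "\<omega> \<in> space M"
      using B[THEN INT_D, of "n * length w"] w by (auto simp: L_def)
    ultimately show "\<omega> \<in> ?A"
      by (auto simp: word_at_def)
  qed
  also have "prob \<dots> = (\<Prod>s\<in>L n. prob (X s -` {w ! (s - n * length w)} \<inter> space M))"
    using w by (intro indep_varsD[OF indep]) (auto simp: L_def)
  also have "\<dots> = (\<Prod>s\<in>L n. \<mu> (w ! (s - n * length w)))"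
  proof (rule prod.cong[OF refl])
    fix s assume "s \<in> L n"
    then have "w ! (s - n * length w) \<in> set w"
      by (intro nth_mem) (auto simp: L_def)
    from law[OF this, of s]
    show "prob (X s -` {w ! (s - n * length w)} \<inter> space M) = \<mu> (w ! (s - n * length w))"
      by (simp add: vimage_def Int_def conj_commute)
  qed
  also have "\<dots> = (\<Prod>t<length w. \<mu> (w ! t))"
    by (rule prod.reindex_bij_witness[where i = "\<lambda>t. n * length w + t" and j = "\<lambda>s. s - n * length w"])
      (auto simp: L_def)
  finally have prob: "prob {\<omega> \<in> space M. word_at (\<lambda>s. X s \<omega>) w n} = (\<Prod>t<length w. \<mu> (w ! t))" .
  have "expectation (\<lambda>\<omega>. of_bool (word_at (\<lambda>s. X s \<omega>) w n)) =
      expectation (indicator {\<omega> \<in> space M. word_at (\<lambda>s. X s \<omega>) w n})"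
    by (rule Bochner_Integration.integral_cong) (auto simp: indicator_def)
  also have "\<dots> = prob {\<omega> \<in> space M. word_at (\<lambda>s. X s \<omega>) w n}"
    by (subst Bochner_Integration.integral_indicator) (auto intro!: arg_cong[where f = prob])
  finally show "expectation (\<lambda>\<omega>. of_bool (word_at (\<lambda>s. X s \<omega>) w n)) = (\<Prod>t<length w. \<mu> (w ! t))"
    by (simp add: prob)
qed auto

section \<open>Lyapunov descent over geometric windows\<close>

text \<open>The induction runs over eventual bounds, not along the sequence, because in the
  applications \<open>z n\<close> is compared with values from an earlier window. Finitely many
  decrements of \<open>\<kappa>\<close> lead from \<open>B0\<close> to
  \<open>\<eta>\<close>.\<close>

lemma eventually_descent:
  fixes z :: "'a \<Rightarrow> real"
  assumes "\<kappa> > 0" and init: "eventually (\<lambda>n. z n \<le> B0) F"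
    and step: "\<And>B. eventually (\<lambda>n. z n \<le> B) F \<Longrightarrow> eventually (\<lambda>n. z n \<le> max (B - \<kappa>) \<eta>) F"
  shows "eventually (\<lambda>n. z n \<le> \<eta>) F"
proof -
  have iter: "eventually (\<lambda>n. z n \<le> max (B0 - real m * \<kappa>) \<eta>) F" for m
  proof (induction m)
    case 0
    show ?case
      using init by (rule eventually_mono) auto
  next
    case (Suc m)
    show ?case
      using step[OF Suc] by (rule eventually_mono) (use \<open>\<kappa> > 0\<close> in \<open>auto simp: max_def algebra_simps split: if_splits\<close>)
  qed
  obtain m where "B0 - \<eta> < real m * \<kappa>"
    using reals_Archimedean3[OF \<open>\<kappa> > 0\<close>] by blast
  then show ?thesis
    using iter[of m] by (auto elim!: eventually_mono)
qed

text \<open>The ends of the window \<open>{window_start r n..<n}\<close> have asymptotic ratio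
  \<open>1 + r\<close>. On this scale the sum of steps of order \<open>1 / t\<close> neither
  vanishes nor diverges.\<close>

definition window_start :: "real \<Rightarrow> nat \<Rightarrow> nat" where
  "window_start r n = nat \<lfloor>real n / (1 + r)\<rfloor>"

lemma window_start_bounds:
  assumes "r \<ge> 0"
  shows "window_start r n \<le> n" "real (window_start r n) \<le> real n / (1 + r)"
    "real n / (1 + r) < real (window_start r n) + 1"
proof -
  have "real n / (1 + r) \<ge> 0"
    using assms by simp
  then show 2: "real (window_start r n) \<le> real n / (1 + r)"
    and "real n / (1 + r) < real (window_start r n) + 1"
    unfolding window_start_def by linarith+
  have "real n / (1 + r) \<le> real n"
    using assms by (simp add: field_simps)
  with 2 show "window_start r n \<le> n"
    by linarith
qed

lemma window_start_ratio:
  assumes "r \<ge> 0"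
  shows "(\<lambda>n. real (window_start r n) / real n) \<longlonglongrightarrow> 1 / (1 + r)"
proof (rule real_tendsto_sandwich)
  show "eventually (\<lambda>n. 1 / (1 + r) - 1 / real n \<le> real (window_start r n) / real n) sequentially"
    using eventually_gt_at_top[of 0]
  proof eventually_elim
    case (elim n)
    then have "(real n / (1 + r) - 1) / real n \<le> real (window_start r n) / real n"
      using window_start_bounds(3)[OF assms, of n] by (intro divide_right_mono) auto
    then show ?case
      using elim by (simp add: diff_divide_distrib)
  qed
  show "eventually (\<lambda>n. real (window_start r n) / real n \<le> 1 / (1 + r)) sequentially"
    using eventually_gt_at_top[of 0]
  proof eventually_elim
    case (elim n)
    then have "real (window_start r n) / real n \<le> (real n / (1 + r)) / real n"
      using window_start_bounds(2)[OF assms, of n] by (intro divide_right_mono) auto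
    then show ?case
      using elim by simp
  qed
  have "(\<lambda>n. 1 / (1 + r) - 1 / real n) \<longlonglongrightarrow> 1 / (1 + r) - 0"
    by (intro tendsto_intros lim_1_over_n)
  then show "(\<lambda>n. 1 / (1 + r) - 1 / real n) \<longlonglongrightarrow> 1 / (1 + r)"
    by simp
qed auto

lemma window_start_at_top:
  assumes "r \<ge> 0"
  shows "filterlim (window_start r) at_top sequentially"
proof -
  have "filterlim (\<lambda>n. real (window_start r n) / real n * real n) at_top sequentially"
    using assms by (intro filterlim_tendsto_pos_mult_at_top[OF window_start_ratio _ filterlim_real_sequentially]) auto
  moreover have "eventually (\<lambda>n. real (window_start r n) / real n * real n = real (window_start r n)) sequentially"
    using eventually_gt_at_top[of 0] by eventually_elim simp
  ultimately have "filterlim (\<lambda>n. real (window_start r n)) at_top sequentially"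
    by (rule filterlim_mono_eventually[OF _ order_refl order_refl])
  then show ?thesis
    by (simp add: filterlim_sequentially_iff_filterlim_real)
qed

text \<open>The window has at most \<open>n - n / (1 + r) + 1\<close> terms, each at most
  \<open>(1 + r) / n\<close>; the product of the two bounds is
  \<open>r + (1 + r) / n\<close>.\<close>

lemma harmonic_window_le:
  assumes "r > 0"
  shows "eventually (\<lambda>n. (\<Sum>t = window_start r n..<n. 1 / (real t + 1)) \<le> 2 * r) sequentially"
proof -
  \<comment> \<open>Beyond \<open>n0\<close> the rounding term \<open>(1 + r) / n\<close> is at most
    \<open>r\<close>.\<close>
  obtain n0 :: nat where n0: "(1 + r) / r < real n0"
    using reals_Archimedean2 by blast
  show ?thesis
    using eventually_ge_at_top[of "Suc n0"]
  proof eventually_elim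
    case (elim n)
    define k where "k = window_start r n"
    note b = window_start_bounds[OF less_imp_le[OF assms], of n, folded k_def]
    have n: "(1 + r) / r < real n" "real n > 0"
      using n0 elim by auto
    have "(\<Sum>t = k..<n. 1 / (real t + 1)) \<le> (\<Sum>t = k..<n. (1 + r) / real n)"
    proof (rule sum_mono)
      fix t assume "t \<in> {k..<n}"
      then have "real n / (1 + r) \<le> real t + 1"
        using b(3) by auto
      then show "1 / (real t + 1) \<le> (1 + r) / real n"
        using assms n by (simp add: field_simps)
    qed
    also have "\<dots> = (real n - real k) * ((1 + r) / real n)"
      using b(1) by (simp add: of_nat_diff)
    also have "\<dots> \<le> (real n - real n / (1 + r) + 1) * ((1 + r) / real n)"
      using b(3) assms n by (intro mult_right_mono) auto
    also have "\<dots> = r + (1 + r) / real n"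
      using assms n by (simp add: field_simps)
    also have "\<dots> \<le> 2 * r"
      using assms n by (simp add: field_simps)
    finally show ?case
      by (simp add: k_def)
  qed
qed

section \<open>Descent of a Lyapunov function under asynchronous steps\<close>

lemma dist_le_sum_steps:
  fixes x :: "nat \<Rightarrow> 'a::metric_space"
  assumes "\<And>t. dist (x (Suc t)) (x t) \<le> b t" "k \<le> n"
  shows "dist (x n) (x k) \<le> (\<Sum>t = k..<n. b t)"
  using assms(2)
proof (induction n rule: dec_induct)
  case (step n)
  have "dist (x (Suc n)) (x k) \<le> dist (x (Suc n)) (x n) + dist (x n) (x k)"
    by (rule dist_triangle)
  also have "\<dots> \<le> b n + (\<Sum>t = k..<n. b t)"
    using step assms(1) by (intro add_mono) auto
  finally show ?case
    using step by (simp add: add.commute)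
qed simp

lemma le_sum_increments:
  fixes V :: "nat \<Rightarrow> real"
  assumes "\<And>t. V (Suc t) \<le> V t + d t" "k \<le> n"
  shows "V n \<le> V k + (\<Sum>t = k..<n. d t)"
  using assms(2)
proof (induction n rule: dec_induct)
  case (step n)
  then show ?case
    using assms(1)[of n] by simp
qed simp

text \<open>Over a short window the path stays close to its start, so each \<open>h i\<close> is
  nearly frozen there. The weights of every \<open>i\<close> add up to nearly the same
  \<open>ln (1 + r)\<close>; this matters because a single \<open>h i\<close> may be negative and
  only the sum is known to be positive. Hence \<open>V\<close> falls by a fixed amount per window
  until it is small.\<close>

lemma lyapunov_asynchronous:
  fixes x :: "nat \<Rightarrow> 'a::metric_space" and V :: "'a \<Rightarrow> real"
    and h :: "'i::finite \<Rightarrow> 'a \<Rightarrow> real" and a :: "nat \<Rightarrow> 'i \<Rightarrow> real"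
  assumes S: "compact S" "\<And>t. x t \<in> S"
    and V: "continuous_on S V" and h: "\<And>i. continuous_on S (h i)"
    and pos: "\<And>y. y \<in> S \<Longrightarrow> V y > 0 \<Longrightarrow> (\<Sum>i\<in>UNIV. h i y) > 0"
    and A: "A \<ge> 0" "\<And>t. dist (x (Suc t)) (x t) \<le> A / (real t + 1)"
    and a: "\<And>t i. a t i \<ge> 0"
    and total: "\<And>r i. r > 0 \<Longrightarrow> (\<lambda>n. \<Sum>t = window_start r n..<n. a t i) \<longlonglongrightarrow> ln (1 + r)"
    and \<beta>: "\<beta> \<longlonglongrightarrow> 0"
    and descent: "\<And>t. V (x (Suc t)) \<le> V (x t) - (\<Sum>i\<in>UNIV. a t i * h i (x t)) + \<beta> t / (real t + 1)"
    and \<eta>: "\<eta> > 0"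
  shows "eventually (\<lambda>n. V (x n) \<le> \<eta>) sequentially"
proof -
  \<comment> \<open>Compactness turns positivity into a uniform margin \<open>g\<close> where
    \<open>V\<close> is at least \<open>\<eta> / 2\<close>; if there is no such point, any positive
    number serves.\<close>
  obtain g where g: "g > 0" "\<And>y. y \<in> S \<Longrightarrow> V y \<ge> \<eta> / 2 \<Longrightarrow> g \<le> (\<Sum>i\<in>UNIV. h i y)"
  proof (cases "S \<inter> V -` {\<eta> / 2..} = {}")
    case True
    then show ?thesis
      by (intro that[of 1]) auto
  next
    case False
    have "closedin (top_of_set S) (S \<inter> V -` {\<eta> / 2..})"
      using V by (rule continuous_closedin_preimage) simp
    then have comp: "compact (S \<inter> V -` {\<eta> / 2..})"
      using S(1) closedin_compact by blast
    have cont: "continuous_on (S \<inter> V -` {\<eta> / 2..}) (\<lambda>y. \<Sum>i\<in>UNIV. h i y)"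
      by (intro continuous_intros continuous_on_subset[OF h]) auto
    from continuous_attains_inf[OF comp False cont] obtain y0 where
      "y0 \<in> S" "V y0 \<ge> \<eta> / 2"
      "\<And>y. y \<in> S \<Longrightarrow> V y \<ge> \<eta> / 2 \<Longrightarrow> (\<Sum>i\<in>UNIV. h i y0) \<le> (\<Sum>i\<in>UNIV. h i y)"
      by auto
    moreover have "(\<Sum>i\<in>UNIV. h i y0) > 0"
      using calculation(1,2) \<eta> by (intro pos) auto
    ultimately show ?thesis
      by (intro that)
  qed
  define N where "N = real (card (UNIV :: 'i set))"
  have N: "N > 0"
    by (simp add: N_def card_gt_0_iff)
  \<comment> \<open>The ideal decrease \<open>\<sigma> * g\<close> of a window is shared out:
    freezing the \<open>h i\<close> costs \<open>N * \<gamma> = g / 4\<close> per unit of weight,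
    unequal weights cost \<open>\<sigma> * g / 8\<close>, the perturbation \<open>\<beta>\<close>
    another \<open>\<sigma> * g / 8\<close>, and \<open>\<sigma> * g / 2\<close> remains.\<close>
  define \<gamma> where "\<gamma> = g / (4 * N)"
  have \<gamma>: "\<gamma> > 0"
    using g N by (simp add: \<gamma>_def)
  \<comment> \<open>Collecting the \<open>h i\<close> in one vector yields a single modulus of
    continuity for all of them.\<close>
  define H where "H y = (\<chi> i. h i y)" for y
  have "continuous_on S H"
    unfolding H_def by (intro continuous_on_vec_lambda h)
  then have unif_H: "uniformly_continuous_on S H"
    using S(1) by (rule compact_uniformly_continuous)
  have unif_V: "uniformly_continuous_on S V"
    using V S(1) by (rule compact_uniformly_continuous)
  obtain \<delta>1 where \<delta>1: "\<delta>1 > 0"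
    "\<And>y z. y \<in> S \<Longrightarrow> z \<in> S \<Longrightarrow> dist z y < \<delta>1 \<Longrightarrow> dist (H z) (H y) < \<gamma>"
    using unif_H \<gamma> unfolding uniformly_continuous_on_def by metis
  obtain \<delta>2 where \<delta>2: "\<delta>2 > 0"
    "\<And>y z. y \<in> S \<Longrightarrow> z \<in> S \<Longrightarrow> dist z y < \<delta>2 \<Longrightarrow> dist (V z) (V y) < \<eta> / 2"
    using unif_V \<eta> unfolding uniformly_continuous_on_def by (metis half_gt_zero)
  define \<delta> where "\<delta> = min \<delta>1 \<delta>2"
  have \<delta>: "\<delta> > 0"
    using \<delta>1 \<delta>2 by (simp add: \<delta>_def)
  have h_close: "h i y - \<gamma> \<le> h i z" if "y \<in> S" "z \<in> S" "dist z y < \<delta>" for y z i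
  proof -
    have "dist (H z $ i) (H y $ i) < \<gamma>"
      using dist_vec_nth_le[of "H z" i "H y"] \<delta>1(2)[of y z] that by (simp add: \<delta>_def)
    then show ?thesis
      by (simp add: H_def dist_real_def)
  qed
  have "compact (H ` S)"
    by (rule compact_continuous_image) fact+
  then obtain Hm where Hm: "\<And>y. y \<in> S \<Longrightarrow> norm (H y) \<le> Hm"
    using compact_imp_bounded[of "H ` S"] unfolding bounded_iff by auto
  have h_le: "\<bar>h i y - \<gamma>\<bar> \<le> Hm + \<gamma>" if "y \<in> S" for y i
    using Finite_Cartesian_Product.norm_nth_le[of "H y" i] Hm[OF that] \<gamma> by (simp add: H_def)
  \<comment> \<open>By the harmonic bound the path moves at most \<open>2 * A * r\<close> within a
    window; the \<open>+ 1\<close> covers \<open>A = 0\<close>.\<close>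
  define r where "r = \<delta> / (4 * (A + 1))"
  have r: "r > 0" "2 * A * r < \<delta>"
    using \<delta> A(1) by (auto simp: r_def field_simps intro!: add_pos_nonneg)
  define \<sigma> where "\<sigma> = ln (1 + r)"
  have \<sigma>: "\<sigma> > 0"
    using r by (simp add: \<sigma>_def)
  let ?k = "window_start r"
  define s where "s n i = (\<Sum>t = ?k n..<n. a t i)" for n i
  have "(\<lambda>n. \<Sum>i\<in>UNIV. \<bar>s n i - \<sigma>\<bar> * (Hm + \<gamma>)) \<longlonglongrightarrow> (\<Sum>i\<in>(UNIV::'i set). \<bar>\<sigma> - \<sigma>\<bar> * (Hm + \<gamma>))"
    unfolding s_def \<sigma>_def by (intro tendsto_intros total r)
  then have "(\<lambda>n. \<Sum>i\<in>UNIV. \<bar>s n i - \<sigma>\<bar> * (Hm + \<gamma>)) \<longlonglongrightarrow> 0"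
    by simp
  then have D: "eventually (\<lambda>n. (\<Sum>i\<in>UNIV. \<bar>s n i - \<sigma>\<bar> * (Hm + \<gamma>)) < \<sigma> * g / 8) sequentially"
    using \<sigma> g by (intro order_tendstoD) auto
  \<comment> \<open>Together with the harmonic bound \<open>2 * r\<close> this yields exactly the
    share \<open>\<sigma> * g / 8\<close>.\<close>
  define \<beta>' where "\<beta>' = \<sigma> * g / (16 * r)"
  have "\<beta>' > 0"
    using \<sigma> g r by (simp add: \<beta>'_def)
  then have "eventually (\<lambda>t. \<beta> t < \<beta>') sequentially"
    using \<beta> by (intro order_tendstoD)
  then obtain t0 where t0: "\<And>t. t \<ge> t0 \<Longrightarrow> \<beta> t \<le> \<beta>'"
    by (auto simp: eventually_at_top_linorder intro: less_imp_le)
  have k_ge: "eventually (\<lambda>n. ?k n \<ge> t0) sequentially"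
    using window_start_at_top[OF less_imp_le[OF r(1)]] by (simp add: filterlim_at_top)
  have main: "eventually (\<lambda>n. V (x n) \<le> max (V (x (?k n)) - \<sigma> * g / 2) \<eta>) sequentially"
    using D k_ge harmonic_window_le[OF r(1)]
  proof eventually_elim
    case (elim n)
    define k where "k = ?k n"
    have k: "k \<le> n" "k \<ge> t0"
      using elim window_start_bounds(1)[OF less_imp_le[OF r(1)]] by (auto simp: k_def)
    have W: "(\<Sum>t = k..<n. 1 / (real t + 1)) \<le> 2 * r"
      using elim by (simp add: k_def)
    have near: "dist (x t) (x k) < \<delta>" if "k \<le> t" "t \<le> n" for t
    proof -
      have "dist (x t) (x k) \<le> (\<Sum>s = k..<t. A / (real s + 1))"
        using A(2) that(1) by (rule dist_le_sum_steps)
      also have "\<dots> \<le> (\<Sum>s = k..<n. A / (real s + 1))"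
        using that A(1) by (intro sum_mono2) auto
      also have "\<dots> = A * (\<Sum>s = k..<n. 1 / (real s + 1))"
        by (simp add: sum_distrib_left)
      also have "\<dots> \<le> A * (2 * r)"
        using W A(1) by (rule mult_left_mono)
      finally show ?thesis
        using r(2) by simp
    qed
    show ?case
    proof (cases "V (x k) \<ge> \<eta> / 2")
      \<comment> \<open>\<open>V\<close> varies by less than \<open>\<eta> / 2\<close> from the
        start of the window, so a start below \<open>\<eta> / 2\<close> ends below
        \<open>\<eta>\<close>.\<close>
      case False
      moreover have "dist (V (x n)) (V (x k)) < \<eta> / 2"
        using \<delta>2(2)[of "x k" "x n"] near[of n] k S(2) by (simp add: \<delta>_def)
      ultimately have "V (x n) \<le> \<eta>"
        unfolding dist_real_def by linarith
      then show ?thesis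
        by simp
    next
      case True
      have "V (x n) \<le> V (x k) + (\<Sum>t = k..<n. - (\<Sum>i\<in>UNIV. a t i * h i (x t)) + \<beta> t / (real t + 1))"
        using descent k(1) by (intro le_sum_increments) (auto simp: algebra_simps)
      also have "\<dots> \<le> V (x k) + (\<Sum>t = k..<n. - (\<Sum>i\<in>UNIV. a t i * (h i (x k) - \<gamma>)) + \<beta>' * (1 / (real t + 1)))"
        using near k t0 S(2) by (intro add_left_mono sum_mono add_mono le_imp_neg_le mult_left_mono a h_close)
          (auto simp: divide_right_mono)
      also have "(\<Sum>t = k..<n. - (\<Sum>i\<in>UNIV. a t i * (h i (x k) - \<gamma>)) + \<beta>' * (1 / (real t + 1)))
         = - (\<Sum>t = k..<n. \<Sum>i\<in>UNIV. a t i * (h i (x k) - \<gamma>)) + \<beta>' * (\<Sum>t = k..<n. 1 / (real t + 1))"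
        by (simp only: sum.distrib sum_negf sum_distrib_left)
      also have "(\<Sum>t = k..<n. \<Sum>i\<in>UNIV. a t i * (h i (x k) - \<gamma>)) = (\<Sum>i\<in>UNIV. s n i * (h i (x k) - \<gamma>))"
        by (subst sum.swap) (simp add: s_def k_def sum_distrib_right)
      finally have 1: "V (x n) \<le> V (x k) - (\<Sum>i\<in>UNIV. s n i * (h i (x k) - \<gamma>)) + \<beta>' * (\<Sum>t = k..<n. 1 / (real t + 1))"
        by simp
      have 2: "\<beta>' * (\<Sum>t = k..<n. 1 / (real t + 1)) \<le> \<sigma> * g / 8"
      proof -
        have "\<beta>' * (\<Sum>t = k..<n. 1 / (real t + 1)) \<le> \<beta>' * (2 * r)"
          using W \<open>\<beta>' > 0\<close> by (intro mult_left_mono) auto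
        also have "\<dots> = \<sigma> * g / 8"
          using r by (simp add: \<beta>'_def)
        finally show ?thesis .
      qed
      have "(\<Sum>i\<in>UNIV. \<sigma> * (h i (x k) - \<gamma>)) - (\<Sum>i\<in>UNIV. s n i * (h i (x k) - \<gamma>))
          = (\<Sum>i\<in>UNIV. (\<sigma> - s n i) * (h i (x k) - \<gamma>))"
        by (simp only: sum_subtractf[symmetric] left_diff_distrib)
      also have "\<dots> \<le> (\<Sum>i\<in>UNIV. \<bar>s n i - \<sigma>\<bar> * (Hm + \<gamma>))"
      proof (rule sum_mono)
        fix i
        have "(\<sigma> - s n i) * (h i (x k) - \<gamma>) \<le> \<bar>\<sigma> - s n i\<bar> * \<bar>h i (x k) - \<gamma>\<bar>"
          by (simp flip: abs_mult)
        also have "\<dots> \<le> \<bar>\<sigma> - s n i\<bar> * (Hm + \<gamma>)"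
          using h_le[OF S(2)] by (intro mult_left_mono) auto
        finally show "(\<sigma> - s n i) * (h i (x k) - \<gamma>) \<le> \<bar>s n i - \<sigma>\<bar> * (Hm + \<gamma>)"
          by (simp add: abs_minus_commute)
      qed
      also have "\<dots> \<le> \<sigma> * g / 8"
        using elim by simp
      finally have 3: "(\<Sum>i\<in>UNIV. \<sigma> * (h i (x k) - \<gamma>)) - \<sigma> * g / 8 \<le> (\<Sum>i\<in>UNIV. s n i * (h i (x k) - \<gamma>))"
        by simp
      have "(\<Sum>i\<in>UNIV. \<sigma> * (h i (x k) - \<gamma>)) = \<sigma> * (\<Sum>i\<in>UNIV. h i (x k)) - \<sigma> * (N * \<gamma>)"
        by (simp add: sum_distrib_left right_diff_distrib sum_subtractf N_def)
      moreover have "N * \<gamma> = g / 4"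
        using N by (simp add: \<gamma>_def)
      moreover have "\<sigma> * g \<le> \<sigma> * (\<Sum>i\<in>UNIV. h i (x k))"
        using g(2)[OF S(2) True] \<sigma> by (intro mult_left_mono) auto
      ultimately have "(\<Sum>i\<in>UNIV. \<sigma> * (h i (x k) - \<gamma>)) \<ge> \<sigma> * g - \<sigma> * (g / 4)"
        by simp
      with 1 2 3 show ?thesis
        by (simp add: k_def)
    qed
  qed
  have "compact (V ` S)"
    using V S(1) by (rule compact_continuous_image)
  then obtain B0 where B0: "\<And>y. y \<in> S \<Longrightarrow> norm (V y) \<le> B0"
    using compact_imp_bounded[of "V ` S"] unfolding bounded_iff by auto
  show ?thesis
  proof (rule eventually_descent)
    show "\<sigma> * g / 2 > 0"
      using \<sigma> g by simp
    show "eventually (\<lambda>n. V (x n) \<le> B0) sequentially"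
      using S(2) B0 by (intro always_eventually allI) (metis abs_le_D1 real_norm_def)
    fix B assume "eventually (\<lambda>n. V (x n) \<le> B) sequentially"
    then have "eventually (\<lambda>n. V (x (?k n)) \<le> B) sequentially"
      using window_start_at_top[OF less_imp_le[OF r(1)]] by (rule eventually_compose_filterlim)
    with main show "eventually (\<lambda>n. V (x n) \<le> max (B - \<sigma> * g / 2) \<eta>) sequentially"
      by eventually_elim auto
  qed
qed

section \<open>Counts and harmonic numbers over windows\<close>

lemma window_frequency:
  fixes G :: "nat \<Rightarrow> nat"
  assumes freq: "(\<lambda>n. real (G n) / real n) \<longlonglongrightarrow> \<pi>" and "r \<ge> 0"
  shows "(\<lambda>n. real (G (window_start r n)) / real n) \<longlonglongrightarrow> \<pi> / (1 + r)"
proof -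
  let ?k = "window_start r"
  note k = window_start_at_top[OF assms(2)]
  have "(\<lambda>n. real (G (?k n)) / real (?k n) * (real (?k n) / real n)) \<longlonglongrightarrow> \<pi> * (1 / (1 + r))"
    by (intro tendsto_intros filterlim_compose[OF freq k] window_start_ratio assms)
  moreover have "eventually (\<lambda>n. real (G (?k n)) / real (?k n) * (real (?k n) / real n) = real (G (?k n)) / real n) sequentially"
    using eventually_compose_filterlim[OF eventually_gt_at_top[of "0::nat"] k] by eventually_elim simp
  ultimately have "(\<lambda>n. real (G (?k n)) / real n) \<longlonglongrightarrow> \<pi> * (1 / (1 + r))"
    by (rule Lim_transform_eventually)
  then show ?thesis
    by simp
qed

text \<open>\<open>harm m - ln m\<close> tends to the Euler-Mascheroni constant at both ends of the
  window and cancels, which leaves the logarithm of the ratio of the two counts. In that ratio the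
  frequency \<open>\<pi>\<close> cancels as well.\<close>

lemma harm_window_tendsto:
  fixes G :: "nat \<Rightarrow> nat"
  assumes freq: "(\<lambda>n. real (G n) / real n) \<longlonglongrightarrow> \<pi>" and \<pi>: "\<pi> > 0" and r: "r > 0"
  shows "(\<lambda>n. harm (G n) - harm (G (window_start r n))) \<longlonglongrightarrow> ln (1 + r)"
proof -
  let ?k = "window_start r"
  note k = window_start_at_top[OF less_imp_le[OF r]]
  have "filterlim (\<lambda>n. real (G n) / real n * real n) at_top sequentially"
    by (rule filterlim_tendsto_pos_mult_at_top[OF freq \<pi> filterlim_real_sequentially])
  moreover have "eventually (\<lambda>n. real (G n) / real n * real n = real (G n)) sequentially"
    using eventually_gt_at_top[of 0] by eventually_elim simp
  ultimately have "filterlim (\<lambda>n. real (G n)) at_top sequentially"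
    by (rule filterlim_mono_eventually[OF _ order_refl order_refl])
  then have G: "filterlim G at_top sequentially"
    by (simp add: filterlim_sequentially_iff_filterlim_real)
  have 1: "(\<lambda>n. harm (G n) - ln (real (G n))) \<longlonglongrightarrow> euler_mascheroni"
    using filterlim_compose[OF euler_mascheroni_LIMSEQ G] by simp
  then have 2: "(\<lambda>n. harm (G (?k n)) - ln (real (G (?k n)))) \<longlonglongrightarrow> euler_mascheroni"
    by (rule filterlim_compose[OF _ k])
  have "(\<lambda>n. (real (G n) / real n) / ((real (G (?k n)) / real (?k n)) * (real (?k n) / real n)))
      \<longlonglongrightarrow> \<pi> / (\<pi> * (1 / (1 + r)))"
    using \<pi> r by (intro tendsto_intros freq filterlim_compose[OF freq k] window_start_ratio) auto
  also have "\<pi> / (\<pi> * (1 / (1 + r))) = 1 + r"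
    using \<pi> r by (simp add: field_simps)
  finally have "(\<lambda>n. ln ((real (G n) / real n) / ((real (G (?k n)) / real (?k n)) * (real (?k n) / real n))))
      \<longlonglongrightarrow> ln (1 + r)"
    using r by (intro tendsto_intros) auto
  moreover have "eventually (\<lambda>n. n > 0 \<and> ?k n > 0 \<and> G n > 0 \<and> G (?k n) > 0) sequentially"
    using eventually_gt_at_top[of "0::nat"] eventually_compose_filterlim[OF eventually_gt_at_top[of "0::nat"] k]
      eventually_compose_filterlim[OF eventually_gt_at_top[of "0::nat"] G]
      eventually_compose_filterlim[OF eventually_gt_at_top[of "0::nat"] filterlim_compose[OF G k]]
    by eventually_elim auto
  then have "eventually (\<lambda>n. ln ((real (G n) / real n) / ((real (G (?k n)) / real (?k n)) * (real (?k n) / real n)))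
      = ln (real (G n)) - ln (real (G (?k n)))) sequentially"
    by eventually_elim (simp add: ln_div field_simps)
  ultimately have "(\<lambda>n. ln (real (G n)) - ln (real (G (?k n)))) \<longlonglongrightarrow> ln (1 + r)"
    by (rule Lim_transform_eventually)
  then have "(\<lambda>n. (harm (G n) - ln (real (G n))) - (harm (G (?k n)) - ln (real (G (?k n))))
      + (ln (real (G n)) - ln (real (G (?k n))))) \<longlonglongrightarrow> euler_mascheroni - euler_mascheroni + ln (1 + r)"
    by (intro tendsto_intros 1 2)
  then show ?thesis
    by simp
qed

section \<open>Consensus by pairwise averaging\<close>

definition pair_average :: "'p \<times> 'p \<Rightarrow> real ^ 'n ^ 'p::finite \<Rightarrow> real ^ 'n ^ 'p" where
  "pair_average e v = (\<chi> i. if i \<in> {fst e, snd e} then (1 / 2) *\<^sub>R (v $ fst e + v $ snd e) else v $ i)"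

lemma linear_pair_average: "linear (pair_average e)"
  by (rule linearI) (auto simp: pair_average_def vec_eq_iff algebra_simps)

lemma pair_average_nth:
  "pair_average e v $ fst e = (1 / 2) *\<^sub>R (v $ fst e + v $ snd e)"
  "pair_average e v $ snd e = (1 / 2) *\<^sub>R (v $ fst e + v $ snd e)"
  by (simp_all add: pair_average_def)

lemma pair_average_fixed: "v $ fst e = v $ snd e \<Longrightarrow> pair_average e v = v"
  by (auto simp: pair_average_def vec_eq_iff scaleR_half_double)

lemma sum_split_pair:
  fixes f :: "'p::finite \<Rightarrow> 'b::comm_monoid_add"
  assumes "a \<noteq> b"
  shows "sum f UNIV = f a + f b + sum f (UNIV - {a, b})"
proof -
  have "sum f UNIV = sum f {a, b} + sum f (UNIV - {a, b})"
    by (subst add.commute) (rule sum.subset_diff; simp)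
  then show ?thesis
    using assms by simp
qed

lemma aggregate_pair_average: "aggregate (pair_average e v) = aggregate v"
proof (cases "fst e = snd e")
  case True
  then have "pair_average e v = v"
    by (intro pair_average_fixed) simp
  then show ?thesis
    by simp
next
  case False
  have "(\<Sum>i\<in>UNIV - {fst e, snd e}. pair_average e v $ i) = (\<Sum>i\<in>UNIV - {fst e, snd e}. v $ i)"
    by (rule sum.cong) (auto simp: pair_average_def)
  moreover have "(1 / 2) *\<^sub>R (v $ fst e + v $ snd e) + (1 / 2) *\<^sub>R (v $ fst e + v $ snd e) = v $ fst e + v $ snd e"
    by (simp only: scaleR_add_right[symmetric] scaleR_half_double)
  ultimately show ?thesis
    unfolding aggregate_def sum_split_pair[OF False] pair_average_nth by (rule arg_cong2[where f = "(+)", rotated])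
qed

text \<open>The parallelogram law at the two averaged components. The explicit loss identifies the
  vectors on which averaging loses nothing.\<close>

lemma norm_pair_average_sq:
  "(norm (pair_average e v))\<^sup>2 = (norm v)\<^sup>2 - (norm (v $ fst e - v $ snd e))\<^sup>2 / 2"
proof (cases "fst e = snd e")
  case True
  then have "pair_average e v = v"
    by (intro pair_average_fixed) simp
  then show ?thesis
    using True by simp
next
  case False
  have rest: "(\<Sum>i\<in>UNIV - {fst e, snd e}. pair_average e v $ i \<bullet> pair_average e v $ i)
      = (\<Sum>i\<in>UNIV - {fst e, snd e}. v $ i \<bullet> v $ i)"
    by (rule sum.cong) (auto simp: pair_average_def)
  have average_sq: "((1 / 2) *\<^sub>R (a + b)) \<bullet> ((1 / 2) *\<^sub>R (a + b)) + ((1 / 2) *\<^sub>R (a + b)) \<bullet> ((1 / 2) *\<^sub>R (a + b))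
      = a \<bullet> a + b \<bullet> b - (a - b) \<bullet> (a - b) / 2" for a b :: "real ^ 'n"
    by (simp add: inner_add inner_diff inner_commute[of b a] field_simps)
  have "pair_average e v \<bullet> pair_average e v
      = v \<bullet> v - (v $ fst e - v $ snd e) \<bullet> (v $ fst e - v $ snd e) / 2"
    unfolding inner_vec_def[of "pair_average e v"] inner_vec_def[of v] sum_split_pair[OF False] pair_average_nth rest
      average_sq
    by simp
  then show ?thesis
    by (simp only: power2_norm_eq_inner)
qed

lemma norm_pair_average_le: "norm (pair_average e v) \<le> norm v"
proof (rule power2_le_imp_le)
  show "(norm (pair_average e v))\<^sup>2 \<le> (norm v)\<^sup>2"
    unfolding norm_pair_average_sq by simp
qed simp

lemma linear_fold_pair_average: "linear (fold pair_average w)"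
proof (induction w)
  case Nil
  then show ?case
    using linear_id by (simp add: id_def)
next
  case (Cons e w)
  then show ?case
    using linear_compose[OF linear_pair_average, of "fold pair_average w" e] by (simp add: comp_def)
qed

lemma norm_fold_pair_average_le: "norm (fold pair_average w v) \<le> norm v"
proof (induction w arbitrary: v)
  case (Cons e w)
  show ?case
    using order_trans[OF Cons[of "pair_average e v"] norm_pair_average_le] by simp
qed simp

text \<open>No stage increases the norm, so none may decrease it. A lossless average leaves
  \<open>v\<close> unchanged, hence every pair of the word acts on the same
  \<open>v\<close>.\<close>

lemma fold_pair_average_isometric:
  assumes "norm (fold pair_average w v) = norm v" "e \<in> set w"
  shows "v $ fst e = v $ snd e"
  using assms
proof (induction w)
  case (Cons a w)
  have "norm v \<le> norm (pair_average a v)"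
    using Cons.prems(1) norm_fold_pair_average_le[of w "pair_average a v"] unfolding fold_Cons comp_def by linarith
  then have "norm (pair_average a v) = norm v"
    using norm_pair_average_le[of a v] by linarith
  then have "(norm (v $ fst a - v $ snd a))\<^sup>2 = 0"
    using norm_pair_average_sq[of a v] by simp
  then have a: "v $ fst a = v $ snd a"
    by simp
  have "pair_average a v = v"
    using a by (rule pair_average_fixed)
  with Cons.prems(1) have "norm (fold pair_average w v) = norm v"
    by (simp only: fold_Cons comp_apply)
  with Cons.IH Cons.prems(2) a show ?case
    by auto
qed simp

lemma connected_graph_constant:
  fixes v :: "'a ^ 'p::finite"
  assumes "connected_graph E" "\<And>i j. {i, j} \<in> E \<Longrightarrow> v $ i = v $ j"
  shows "v $ i = v $ j"
proof -
  have "(i, j) \<in> {(a, b). {a, b} \<in> E}\<^sup>*"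
    using assms(1) by (auto simp: connected_graph_def)
  then show ?thesis
    by (induction rule: rtrancl_induct) (use assms(2) in auto)
qed

text \<open>A vector that keeps its norm agrees across every edge, hence is constant by
  connectivity, and a constant vector with zero aggregate is zero. So nonzero vectors lose norm
  strictly, and compactness of the unit sphere makes the factor uniform.\<close>

lemma fold_pair_average_contraction:
  assumes conn: "connected_graph E" and w: "set w = {(i, j). {i, j} \<in> E}"
  obtains l where "0 \<le> l" "l < 1"
    "\<And>v :: real ^ 'n ^ 'p::finite. aggregate v = 0 \<Longrightarrow> norm (fold pair_average w v) \<le> l * norm v"
proof -
  have strict: "norm (fold pair_average w v) < norm v" if "aggregate v = 0" "v \<noteq> 0" for v :: "real ^ 'n ^ 'p"
  proof (rule ccontr)
    assume "\<not> ?thesis"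
    then have "norm (fold pair_average w v) = norm v"
      using norm_fold_pair_average_le[of w v] by simp
    then have "v $ i = v $ j" if "{i, j} \<in> E" for i j
      using fold_pair_average_isometric[of w v "(i, j)"] w that by simp
    then have const: "v $ i = v $ j" for i j
      by (rule connected_graph_constant[OF conn])
    have "v $ i = 0" for i
    proof -
      have "aggregate v = (\<Sum>j\<in>(UNIV :: 'p set). v $ i)"
        unfolding aggregate_def by (rule sum.cong[OF refl const])
      then show ?thesis
        using that(1) by (simp only: sum_constant_scaleR) simp
    qed
    with that(2) show False
      by (simp add: vec_eq_iff)
  qed
  define S where "S = sphere 0 1 \<inter> {v :: real ^ 'n ^ 'p. aggregate v = 0}"
  have "closed {v :: real ^ 'n ^ 'p. aggregate v = 0}"
    unfolding aggregate_def by (intro closed_Collect_eq continuous_intros)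
  then have "compact S"
    unfolding S_def by (intro compact_Int_closed compact_sphere)
  have cont: "continuous_on S (\<lambda>v. norm (fold pair_average w v))"
    by (intro continuous_intros linear_continuous_on linear_linear[THEN iffD2] linear_fold_pair_average)
  obtain l where l: "0 \<le> l" "l < 1" "\<And>v. v \<in> S \<Longrightarrow> norm (fold pair_average w v) \<le> l"
  \<comment> \<open>\<open>S\<close> is empty when there is a single player, since a zero aggregate
    then forces \<open>v = 0\<close>.\<close>
  proof (cases "S = {}")
    case True
    then show ?thesis
      by (intro that[of 0]) auto
  next
    case False
    from continuous_attains_sup[OF \<open>compact S\<close> False cont] obtain u where u: "u \<in> S"
      "\<And>v. v \<in> S \<Longrightarrow> norm (fold pair_average w v) \<le> norm (fold pair_average w u)"
      by auto
    have "norm (fold pair_average w u) < 1"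
      using strict[of u] u(1) by (cases "u = 0") (auto simp: S_def)
    with u show ?thesis
      by (intro that[of "norm (fold pair_average w u)"]) auto
  qed
  show ?thesis
  proof (rule that[OF l(1,2)])
    fix v :: "real ^ 'n ^ 'p" assume v: "aggregate v = 0"
    show "norm (fold pair_average w v) \<le> l * norm v"
    proof (cases "v = 0")
      case True
      then show ?thesis
        using norm_fold_pair_average_le[of w v] by simp
    next
      case False
      then have "inverse (norm v) *\<^sub>R v \<in> S"
        using v by (simp add: S_def aggregate_def flip: scaleR_sum_right)
      from l(3)[OF this] show ?thesis
        using False by (simp add: linear_scale[OF linear_fold_pair_average] field_simps)
    qed
  qed
qed

section \<open>Occurrences of the word and decay of the disagreement\<close>

lemma word_at_imp_map:
  assumes "word_at c w n"
  shows "map c [n * length w..<n * length w + length w] = w"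
  using assms by (intro nth_equalityI) (auto simp: word_at_def)

text \<open>The number of occurrences grows linearly in time, so across a window it grows by a
  positive multiple of \<open>n\<close>. More than one occurrence is asked for, as one may lie in
  the block that the window start cuts.\<close>

lemma word_in_window:
  assumes freq: "(\<lambda>n. (\<Sum>t<n. of_bool (word_at c w t)) / real n) \<longlonglongrightarrow> q" and q: "q > 0"
    and w: "w \<noteq> []" and r: "r > 0"
  shows "eventually (\<lambda>n. \<exists>m. word_at c w m \<and> window_start r n \<le> m * length w \<and>
    m * length w + length w \<le> n) sequentially"
proof -
  define G where "G n = (\<Sum>t<n. of_bool (word_at c w t) :: nat)" for n
  have freq': "(\<lambda>n. real (G n) / real n) \<longlonglongrightarrow> q"
    using freq by (simp add: G_def of_nat_sum)
  define T where "T = length w"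
  have T: "T > 0"
    using w by (simp add: T_def)
  \<comment> \<open>The number of blocks completed by time \<open>n\<close> is itself a window
    start, of ratio \<open>T\<close>, so \<open>window_frequency\<close> converts frequencies per
    block into frequencies per contact.\<close>
  have div: "window_start (real T - 1) n = n div T" for n
    by (simp add: window_start_def floor_divide_of_nat_eq)
  have lim: "(\<lambda>n. real (G (n div T)) / real n) \<longlonglongrightarrow> q / real T"
    using window_frequency[OF freq', of "real T - 1"] T by (simp add: div)
  have lim': "(\<lambda>n. real (G (window_start r n div T)) / real n) \<longlonglongrightarrow> (q / real T) / (1 + r)"
    using window_frequency[OF lim, of r] r by simp
  define d where "d = q / real T - (q / real T) / (1 + r)"
  have "d > 0"
    using mult_strict_left_mono[of "1 / (1 + r)" 1 "q / real T"] q T r by (simp add: d_def)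
  have "(\<lambda>n. real (G (n div T)) / real n - real (G (window_start r n div T)) / real n - 1 / real n) \<longlonglongrightarrow> d - 0"
    unfolding d_def by (intro tendsto_intros lim lim' lim_1_over_n)
  then have "eventually (\<lambda>n. real (G (n div T)) / real n - real (G (window_start r n div T)) / real n - 1 / real n > 0) sequentially"
    using \<open>d > 0\<close> by (intro order_tendstoD(1)[where y = "d - 0"]) auto
  with eventually_gt_at_top[of 0] show ?thesis
  proof eventually_elim
    case (elim n)
    \<comment> \<open>The block \<open>s\<close> contains the window start and may begin before it,
      so the search starts at \<open>Suc s\<close>.\<close>
    define s where "s = window_start r n div T"
    have "0 < (real (G (n div T)) - real (G s) - 1) / real n"
      using elim by (simp add: s_def diff_divide_distrib)
    then have "G s + 1 < G (n div T)"
      using elim by (simp add: zero_less_divide_iff)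
    moreover have "G (Suc s) \<le> G s + 1"
      by (simp add: G_def)
    ultimately have less: "G (Suc s) < G (n div T)"
      by simp
    have "\<exists>m\<in>{Suc s..<n div T}. word_at c w m"
    proof (rule ccontr)
      assume *: "\<not> ?thesis"
      have "G (n div T) = (\<Sum>t\<in>{..<n div T} \<inter> {..<Suc s}. of_bool (word_at c w t))"
        unfolding G_def using * by (intro sum.mono_neutral_right) (auto simp: not_less)
      also have "\<dots> \<le> G (Suc s)"
        unfolding G_def by (intro sum_mono2) auto
      finally show False
        using less by simp
    qed
    then obtain m where m: "word_at c w m" "Suc s \<le> m" "Suc m \<le> n div T"
      by auto
    have "window_start r n \<le> Suc s * T"
      using T dividend_less_div_times[of T "window_start r n"] by (simp add: s_def)
    also have "\<dots> \<le> m * T"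
      using m(2) by (rule mult_le_mono1)
    finally have "window_start r n \<le> m * T" .
    moreover have "Suc m * T \<le> n"
      using m(3) T by (simp only: less_eq_div_iff_mult_less_eq)
    ultimately show ?case
      using m(1) by (auto simp: T_def intro!: exI[of _ m])
  qed
qed

text \<open>One occurrence of the word contracts by \<open>l\<close>, the other averages in the
  window do not expand, and the perturbations add little. An eventual bound \<open>B\<close> thus
  improves to \<open>l * B + \<kappa>\<close>, which is at most \<open>B - \<kappa>\<close> or at
  most \<open>\<eta>\<close>.\<close>

lemma consensus_tendsto_zero:
  fixes z :: "nat \<Rightarrow> real ^ 'n ^ 'p::finite"
  assumes conn: "connected_graph E" and w: "set w = {(i, j). {i, j} \<in> E}" "w \<noteq> []"
    and freq: "(\<lambda>n. (\<Sum>t<n. of_bool (word_at c w t)) / real n) \<longlonglongrightarrow> q" "q > 0"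
    and z: "\<And>t. aggregate (z t) = 0" "\<And>t. norm (z t) \<le> Z"
    and A: "A \<ge> 0" "\<And>t. norm (z (Suc t) - pair_average (c t) (z t)) \<le> A / (real t + 1)"
  shows "z \<longlonglongrightarrow> 0"
proof -
  obtain l where l: "0 \<le> l" "l < 1"
    "\<And>v :: real ^ 'n ^ 'p. aggregate v = 0 \<Longrightarrow> norm (fold pair_average w v) \<le> l * norm v"
    using fold_pair_average_contraction[OF conn w(1)] by metis
  have step: "norm (z (Suc t)) \<le> norm (z t) + A / (real t + 1)" for t
    using norm_triangle_sub[of "z (Suc t)" "pair_average (c t) (z t)"]
      norm_pair_average_le[of "c t" "z t"] A(2)[of t] by simp
  \<comment> \<open>Averages are linear and nonexpansive, so perturbations add up without
    amplification.\<close>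
  have fold: "norm (z (k + m) - fold pair_average (map c [k..<k + m]) (z k))
      \<le> (\<Sum>t = k..<k + m. A / (real t + 1))" for k m
  proof (induction m)
    case (Suc m)
    let ?y = "fold pair_average (map c [k..<k + m]) (z k)"
    have "norm (z (Suc (k + m)) - pair_average (c (k + m)) ?y)
        \<le> norm (z (Suc (k + m)) - pair_average (c (k + m)) (z (k + m)))
          + norm (pair_average (c (k + m)) (z (k + m)) - pair_average (c (k + m)) ?y)"
      using norm_triangle_ineq[of "z (Suc (k + m)) - pair_average (c (k + m)) (z (k + m))"
        "pair_average (c (k + m)) (z (k + m)) - pair_average (c (k + m)) ?y"] by simp
    also have "pair_average (c (k + m)) (z (k + m)) - pair_average (c (k + m)) ?y
        = pair_average (c (k + m)) (z (k + m) - ?y)"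
      by (simp add: linear_diff[OF linear_pair_average])
    also have "norm \<dots> \<le> norm (z (k + m) - ?y)"
      by (rule norm_pair_average_le)
    also have "norm (z (Suc (k + m)) - pair_average (c (k + m)) (z (k + m))) + norm (z (k + m) - ?y)
        \<le> A / (real (k + m) + 1) + (\<Sum>t = k..<k + m. A / (real t + 1))"
      by (intro add_mono A(2) Suc)
    finally show ?case
      by simp
  qed simp
  show ?thesis
  proof (rule tendsto_norm_zero_cancel, rule tendstoI)
    fix e :: real assume "e > 0"
    define \<eta> where "\<eta> = e / 2"
    have \<eta>: "\<eta> > 0"
      using \<open>e > 0\<close> by (simp add: \<eta>_def)
    \<comment> \<open>Contraction from a bound \<open>B\<close> of at least \<open>\<eta>\<close>
      gains at least \<open>(1 - l) * \<eta> = 2 * \<kappa>\<close>; one \<open>\<kappa>\<close>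
      pays for the perturbations in the window.\<close>
    define \<kappa> where "\<kappa> = (1 - l) * \<eta> / 2"
    have \<kappa>: "\<kappa> > 0"
      using l \<eta> by (simp add: \<kappa>_def)
    have two_\<kappa>: "2 * \<kappa> = (1 - l) * \<eta>"
      by (simp add: \<kappa>_def)
    define r where "r = \<kappa> / (2 * (A + 1))"
    have r: "r > 0" "A * (2 * r) \<le> \<kappa>"
      using \<kappa> A(1) by (auto simp: r_def field_simps)
    have "eventually (\<lambda>n. norm (z n) \<le> \<eta>) sequentially"
    proof (rule eventually_descent[OF \<kappa>])
      show "eventually (\<lambda>n. norm (z n) \<le> Z) sequentially"
        by (simp add: z(2))
      fix B assume "eventually (\<lambda>n. norm (z n) \<le> B) sequentially"
      then obtain t0 where t0: "\<And>t. t \<ge> t0 \<Longrightarrow> norm (z t) \<le> B"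
        by (auto simp: eventually_at_top_linorder)
      have "eventually (\<lambda>n. window_start r n \<ge> t0) sequentially"
        using window_start_at_top[of r] r(1) by (simp add: filterlim_at_top)
      with harmonic_window_le[OF r(1)] word_in_window[OF freq w(2) r(1)]
      show "eventually (\<lambda>n. norm (z n) \<le> max (B - \<kappa>) \<eta>) sequentially"
      proof eventually_elim
        case (elim n)
        then obtain m where m: "word_at c w m" "window_start r n \<le> m * length w" "m * length w + length w \<le> n"
          by auto
        define k where "k = m * length w"
        let ?h = "\<lambda>t. A / (real t + 1)"
        have "norm (z n) \<le> norm (z (k + length w)) + sum ?h {k + length w..<n}"
          using step m(3) by (intro le_sum_increments) (auto simp: k_def)
        also have "norm (z (k + length w)) \<le> norm (fold pair_average w (z k)) + sum ?h {k..<k + length w}"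
          using fold[of k "length w"] norm_triangle_sub[of "z (k + length w)" "fold pair_average w (z k)"]
          unfolding k_def word_at_imp_map[OF m(1)] by linarith
        also have "norm (fold pair_average w (z k)) \<le> l * norm (z k)"
          by (intro l(3) z(1))
        also have "\<dots> \<le> l * B"
          using m(2) elim l(1) by (intro mult_left_mono t0) (auto simp: k_def)
        also have "l * B + sum ?h {k..<k + length w} + sum ?h {k + length w..<n} = l * B + sum ?h {k..<n}"
          using m(3) by (simp add: k_def sum.atLeastLessThan_concat)
        also have "sum ?h {k..<n} \<le> sum ?h {window_start r n..<n}"
          using m(2) A(1) by (intro sum_mono2) (auto simp: k_def)
        also have "\<dots> = A * (\<Sum>t = window_start r n..<n. 1 / (real t + 1))"
          by (simp add: sum_distrib_left)
        also have "\<dots> \<le> A * (2 * r)"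
          using elim A(1) by (intro mult_left_mono) auto
        also have "\<dots> \<le> \<kappa>"
          by (rule r(2))
        finally have z_le: "norm (z n) \<le> l * B + \<kappa>"
          by simp
        show ?case
        proof (cases "B \<ge> \<eta>")
          case True
          then have "(1 - l) * \<eta> \<le> (1 - l) * B"
            using l by (intro mult_left_mono) auto
          also have "\<dots> = B - l * B"
            by (simp add: algebra_simps)
          finally have "norm (z n) \<le> B - \<kappa>"
            using z_le two_\<kappa> by linarith
          then show ?thesis
            by simp
        next
          case False
          then have "l * B \<le> l * \<eta>"
            using l by (intro mult_left_mono) auto
          moreover have "(1 - l) * \<eta> = \<eta> - l * \<eta>"
            by (simp add: algebra_simps)
          ultimately have "norm (z n) \<le> \<eta>"
            using z_le two_\<kappa> \<kappa> by linarith
          then show ?thesis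
            by simp
        qed
      qed
    qed
    then show "eventually (\<lambda>n. dist (norm (z n)) 0 < e) sequentially"
      by (rule eventually_mono) (use \<open>e > 0\<close> in \<open>simp add: \<eta>_def\<close>)
  qed
qed

section \<open>Nash equilibria as solutions of a variational inequality\<close>

text \<open>Both sides are gradients of \<open>z \<mapsto> g z (z + s)\<close> with
  \<open>s = u - x\<close>, and gradients are unique. The right side inherits continuity from the
  total gradient.\<close>

lemma aggregative_grad_eq:
  fixes g :: "'a::real_inner \<Rightarrow> 'a \<Rightarrow> real"
  assumes "GDERIV (\<lambda>(z, w). g z w) (x, u) :> D"
  shows "aggregative_grad g x u = fst D + snd D"
proof -
  define s where "s = u - x"
  have u: "u = x + s"
    by (simp add: s_def)
  have D: "((\<lambda>(z, w). g z w) has_derivative (\<lambda>h. h \<bullet> D)) (at (x, x + s))"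
    using assms by (simp add: gderiv_def u)
  have "((\<lambda>z. (z, z + s)) has_derivative (\<lambda>h. (h, h))) (at x)"
    by (auto intro!: derivative_eq_intros)
  from has_derivative_compose[OF this, where g = "\<lambda>(z, w). g z w"] D
  have "((\<lambda>z. g z (z + s)) has_derivative (\<lambda>h. (h, h) \<bullet> D)) (at x)"
    by simp
  then have "GDERIV (\<lambda>z. g z (z + s)) x :> fst D + snd D"
    by (simp add: gderiv_def inner_prod_def inner_add_right)
  from grad_eqI[OF this] grad_eqI[OF GDERIV_along_aggregate[of g x s D]] assms
  show ?thesis
    by (simp add: u)
qed

lemma continuous_on_aggregative_grad:
  fixes g :: "'a::real_inner \<Rightarrow> 'a \<Rightarrow> real"
  assumes "continuously_differentiable_over U (\<lambda>(x, u). g x u)"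
  shows "continuous_on U (\<lambda>(x, u). aggregative_grad g x u)"
proof -
  obtain D where D: "\<And>z. z \<in> U \<Longrightarrow> GDERIV (\<lambda>(x, u). g x u) z :> D z" "continuous_on U D"
    using assms by (auto simp: continuously_differentiable_over_def)
  have "continuous_on U (\<lambda>z. fst (D z) + snd (D z))"
    by (intro continuous_intros D)
  then show ?thesis
    by (rule continuous_on_eq) (use D(1) aggregative_grad_eq in fastforce)
qed

text \<open>Along the segment from \<open>x\<close> to \<open>z\<close> the claim is the
  one-dimensional first-order condition at the left end.\<close>

lemma convex_minimum_iff:
  fixes g :: "'a::real_inner \<Rightarrow> real"
  assumes conv: "convex_on S g" and x: "x \<in> S" and D: "GDERIV g x :> D"
  shows "(\<forall>z\<in>S. g x \<le> g z) \<longleftrightarrow> (\<forall>z\<in>S. D \<bullet> (z - x) \<ge> 0)"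
proof -
  have deriv: "((\<lambda>t. g (x + t *\<^sub>R (z - x))) has_real_derivative D \<bullet> (z - x)) (at 0)" for z
  proof -
    have "((\<lambda>t. x + t *\<^sub>R (z - x)) has_derivative (\<lambda>t. t *\<^sub>R (z - x))) (at 0)"
      by (auto intro!: derivative_eq_intros)
    moreover have "(g has_derivative (\<lambda>h. h \<bullet> D)) (at (x + 0 *\<^sub>R (z - x)))"
      using D by (simp add: gderiv_def)
    ultimately have "((\<lambda>t. g (x + t *\<^sub>R (z - x))) has_derivative (\<lambda>t. (t *\<^sub>R (z - x)) \<bullet> D)) (at 0)"
      by (rule has_derivative_compose)
    then show ?thesis
      unfolding has_field_derivative_def by (rule has_derivative_eq_rhs) (auto simp: inner_commute)
  qed
  have segment: "x + t *\<^sub>R (z - x) = (1 - t) *\<^sub>R x + t *\<^sub>R z" for t :: real and z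
    by (simp add: algebra_simps)
  have in_S: "x + t *\<^sub>R (z - x) \<in> S" if "z \<in> S" "0 \<le> t" "t \<le> 1" for t z
    unfolding segment using convex_on_imp_convex[OF conv] x that by (intro convexD) auto
  show ?thesis
  proof (intro iffI ballI)
    fix z assume min: "\<forall>z\<in>S. g x \<le> g z" and z: "z \<in> S"
    show "0 \<le> D \<bullet> (z - x)"
    proof (rule ccontr)
      assume "\<not> ?thesis"
      then obtain d where d: "d > 0" "\<And>h. 0 < h \<Longrightarrow> h < d \<Longrightarrow> g (x + h *\<^sub>R (z - x)) < g x"
        using DERIV_neg_dec_right[OF deriv[of z]] by auto
      define h where "h = min (d / 2) 1"
      have "0 < h" "h < d" "h \<le> 1"
        using d(1) by (auto simp: h_def min_def)
      then show False
        using d(2)[of h] min[rule_format, OF in_S[OF z, of h]] by simp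
    qed
  next
    fix z assume nonneg: "\<forall>z\<in>S. 0 \<le> D \<bullet> (z - x)" and z: "z \<in> S"
    show "g x \<le> g z"
    proof (rule ccontr)
      assume less: "\<not> ?thesis"
      \<comment> \<open>Subtracting the slope of the chord leaves a positive derivative at
        \<open>0\<close>, so \<open>g\<close> rises above the chord just to the right of
        \<open>0\<close>, against convexity.\<close>
      let ?\<psi> = "\<lambda>t. g (x + t *\<^sub>R (z - x)) - t * (g z - g x)"
      have "(?\<psi> has_real_derivative D \<bullet> (z - x) - (g z - g x)) (at 0)"
        by (auto intro!: derivative_eq_intros deriv)
      moreover have "D \<bullet> (z - x) - (g z - g x) > 0"
        using less nonneg[rule_format, OF z] by linarith
      ultimately obtain d where d: "d > 0" "\<And>h. 0 < h \<Longrightarrow> h < d \<Longrightarrow> ?\<psi> 0 < ?\<psi> (0 + h)"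
        using DERIV_pos_inc_right[of ?\<psi> "D \<bullet> (z - x) - (g z - g x)" 0] by blast
      define h where "h = min (d / 2) 1"
      have h: "0 < h" "h < d" "h \<le> 1"
        using d(1) by (auto simp: h_def min_def)
      have "g (x + h *\<^sub>R (z - x)) \<le> (1 - h) * g x + h * g z"
        unfolding segment using conv h x z by (intro convex_onD) auto
      then show False
        using d(2)[OF h(1,2)] by (simp add: algebra_simps)
    qed
  qed
qed

section \<open>The set of strategy profiles\<close>

lemma norm_vec_le_sum: "norm x \<le> (\<Sum>i\<in>UNIV. norm (x $ i))"
  unfolding norm_vec_def by (rule L2_set_le_sum) simp

lemma compact_profiles:
  assumes "\<And>i. compact (K i)"
  shows "compact (profiles K)"
proof -
  have "closed (profiles K)"
  proof -
    have "profiles K = (\<Inter>i. (\<lambda>x. x $ i) -` K i)"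
      by (auto simp: profiles_def)
    moreover have "closed ((\<lambda>x. x $ i) -` K i)" for i
      using assms by (intro closed_vimage compact_imp_closed continuous_intros)
    ultimately show ?thesis
      by auto
  qed
  moreover have "bounded (profiles K)"
  proof -
    have "\<exists>b. \<forall>i. \<forall>y\<in>K i. norm y \<le> b i"
      using compact_imp_bounded[OF assms] by (intro choice) (auto simp: bounded_iff)
    then obtain b where b: "\<And>i y. y \<in> K i \<Longrightarrow> norm y \<le> b i"
      by auto
    have "norm x \<le> (\<Sum>i\<in>UNIV. b i)" if "x \<in> profiles K" for x
      using that by (intro order_trans[OF norm_vec_le_sum] sum_mono b) (auto simp: profiles_def)
    then show ?thesis
      by (auto simp: bounded_iff)
  qed
  ultimately show ?thesis
    by (simp add: compact_eq_bounded_closed)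
qed

lemma convex_profiles:
  assumes "\<And>i. convex (K i)"
  shows "convex (profiles K)"
  using assms by (auto simp: profiles_def convex_def)

lemma profiles_nonempty:
  assumes "\<And>i. K i \<noteq> {}"
  shows "profiles K \<noteq> {}"
proof -
  have "(\<chi> i. SOME z. z \<in> K i) \<in> profiles K"
    using assms by (auto simp: profiles_def some_in_eq)
  then show ?thesis
    by auto
qed

lemma continuous_on_aggregate: "continuous_on S aggregate"
  unfolding aggregate_def by (intro continuous_intros)

lemma aggregate_eq_others: "aggregate x = x $ i + aggregate_others i x"
  unfolding aggregate_def aggregate_others_def by (rule sum.remove) auto

text \<open>The open sets \<open>U i\<close> leave room around \<open>aggregates K\<close>, which
  the scaled estimates need not hit exactly; there \<open>F i\<close> is the gradient and hence
  continuous.\<close>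

locale aggregative_game =
  fixes K :: "'p::finite \<Rightarrow> (real ^ 'n) set"
    and f :: "'p \<Rightarrow> real ^ 'n \<Rightarrow> real ^ 'n \<Rightarrow> real"
    and F :: "'p \<Rightarrow> real ^ 'n \<Rightarrow> real ^ 'n \<Rightarrow> real ^ 'n"
    and U :: "'p \<Rightarrow> ((real ^ 'n) \<times> (real ^ 'n)) set"
  assumes K: "\<And>i. K i \<noteq> {} \<and> compact (K i) \<and> convex (K i)"
    and U: "\<And>i. open (U i) \<and> K i \<times> aggregates K \<subseteq> U i"
    and f_diff: "\<And>i. continuously_differentiable_over (U i) (\<lambda>(x, u). f i x u)"
    and f_convex: "\<And>i x. x \<in> profiles K \<Longrightarrow>
        convex_on (K i) (\<lambda>z. f i z (z + aggregate_others i x))"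
    and F: "\<And>i x u. (x, u) \<in> U i \<Longrightarrow> F i x u = aggregative_grad (f i) x u"
    and monotone: "\<And>x y. x \<in> profiles K \<Longrightarrow> y \<in> profiles K \<Longrightarrow> x \<noteq> y \<Longrightarrow>
        (game_map F x - game_map F y) \<bullet> (x - y) > 0"
begin

lemma F_continuous: "continuous_on (U i) (\<lambda>(x, u). F i x u)"
  using continuous_on_aggregative_grad[OF f_diff] by (rule continuous_on_eq) (auto simp: F)

lemma profile_in_U: "x \<in> profiles K \<Longrightarrow> (x $ i, aggregate x) \<in> U i"
  using U[of i] by (auto simp: profiles_def aggregates_def)

lemma game_map_continuous: "continuous_on (profiles K) (game_map F)"
proof -
  have "continuous_on (profiles K) (\<lambda>x. F i (x $ i) (aggregate x))" for i
  proof -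
    have "continuous_on (profiles K) (\<lambda>x. (x $ i, aggregate x))"
      by (intro continuous_intros continuous_on_aggregate)
    then have "continuous_on (profiles K) (\<lambda>x. case (x $ i, aggregate x) of (x, u) \<Rightarrow> F i x u)"
      by (rule continuous_on_compose2[OF F_continuous]) (use profile_in_U in blast)
    then show ?thesis
      by simp
  qed
  then show ?thesis
    unfolding game_map_def by (rule continuous_on_vec_lambda)
qed

text \<open>With the other decisions fixed, the problem of player \<open>i\<close> is convex and has
  the gradient \<open>game_map F x $ i\<close> at \<open>x $ i\<close>, so a best response is
  characterised by its first-order condition.\<close>

lemma nash_iff_variational:
  "nash_equilibrium K f x \<longleftrightarrow>
    x \<in> profiles K \<and> (\<forall>i. \<forall>z\<in>K i. game_map F x $ i \<bullet> (z - x $ i) \<ge> 0)"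
proof -
  have "(\<forall>z\<in>K i. f i (x $ i) (x $ i + aggregate_others i x) \<le> f i z (z + aggregate_others i x))
      \<longleftrightarrow> (\<forall>z\<in>K i. game_map F x $ i \<bullet> (z - x $ i) \<ge> 0)" if x: "x \<in> profiles K" for i
  proof (rule convex_minimum_iff)
    show "convex_on (K i) (\<lambda>z. f i z (z + aggregate_others i x))"
      using x by (rule f_convex)
    show "x $ i \<in> K i"
      using x by (simp add: profiles_def)
    have U': "(x $ i, x $ i + aggregate_others i x) \<in> U i"
      using profile_in_U[OF x, of i] by (simp add: aggregate_eq_others[of x i])
    then obtain D where "GDERIV (\<lambda>(z, w). f i z w) (x $ i, x $ i + aggregate_others i x) :> D"
      using f_diff[of i] unfolding continuously_differentiable_over_def by blast
    from GDERIV_along_aggregate[OF this]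
    show "GDERIV (\<lambda>z. f i z (z + aggregate_others i x)) (x $ i) :> game_map F x $ i"
      using F[OF U'] by (simp add: game_map_def aggregate_eq_others[of x i])
  qed
  then show ?thesis
    by (auto simp: nash_equilibrium_def)
qed

lemma nash_exists: "\<exists>x. nash_equilibrium K f x"
proof -
  \<comment> \<open>A projected gradient step of unit length. Brouwer's theorem gives a fixed point,
    and the obtuse-angle property of projections turns it into a solution of the variational
    inequality.\<close>
  define T where "T x = (\<chi> i. closest_point (K i) (x $ i - game_map F x $ i))" for x
  have T_nth: "T x $ i = closest_point (K i) (x $ i - game_map F x $ i)" for x i
    by (simp add: T_def)
  have K': "convex (K i)" "closed (K i)" "K i \<noteq> {}" for i
    using K[of i] by (auto intro: compact_imp_closed)
  have "continuous_on (profiles K) T"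
    unfolding T_def
  proof (rule continuous_on_vec_lambda)
    fix i
    show "continuous_on (profiles K) (\<lambda>x. closest_point (K i) (x $ i - game_map F x $ i))"
      by (rule continuous_on_compose2[OF continuous_on_closest_point[OF K', of UNIV]])
        (intro continuous_intros game_map_continuous, simp)
  qed
  moreover have "T \<in> profiles K \<rightarrow> profiles K"
  proof
    fix x show "T x \<in> profiles K"
      using closest_point_in_set[OF K'(2,3)] by (simp add: T_nth profiles_def)
  qed
  moreover have "compact (profiles K)" "convex (profiles K)" "profiles K \<noteq> {}"
    using K by (auto intro!: compact_profiles convex_profiles profiles_nonempty)
  ultimately obtain x where x: "x \<in> profiles K" "T x = x"
    by (metis brouwer)
  have "game_map F x $ i \<bullet> (z - x $ i) \<ge> 0" if "z \<in> K i" for i z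
  proof -
    have "x $ i = closest_point (K i) (x $ i - game_map F x $ i)"
      using T_nth[of x i] unfolding x(2) .
    then have "(x $ i - game_map F x $ i - x $ i) \<bullet> (z - x $ i) \<le> 0"
      using closest_point_dot[OF K'(1,2) that, of "x $ i - game_map F x $ i"] by simp
    then show ?thesis
      by simp
  qed
  with x(1) have "nash_equilibrium K f x"
    by (simp add: nash_iff_variational)
  then show ?thesis
    by blast
qed

lemma variational_sum:
  assumes "nash_equilibrium K f x" "y \<in> profiles K"
  shows "game_map F x \<bullet> (y - x) \<ge> 0"
proof -
  have "game_map F x \<bullet> (y - x) = (\<Sum>i\<in>UNIV. game_map F x $ i \<bullet> (y $ i - x $ i))"
    by (simp add: inner_vec_def[of "game_map F x"])
  also have "\<dots> \<ge> 0"
    using assms by (intro sum_nonneg) (auto simp: nash_iff_variational profiles_def)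
  finally show ?thesis .
qed

text \<open>At the equilibrium the pairing of \<open>game_map F x\<close> with \<open>y - x\<close>
  is nonnegative, and strict monotonicity makes the one at \<open>y\<close> larger. This sign drives
  the Lyapunov descent.\<close>

lemma monotone_at_nash:
  assumes "nash_equilibrium K f x" "y \<in> profiles K" "y \<noteq> x"
  shows "game_map F y \<bullet> (y - x) > 0"
proof -
  have "x \<in> profiles K"
    using assms(1) by (simp add: nash_iff_variational)
  from monotone[OF assms(2) this assms(3)] variational_sum[OF assms(1,2)] show ?thesis
    by (simp add: inner_diff_left)
qed

lemma nash_unique:
  assumes "nash_equilibrium K f x" "nash_equilibrium K f y"
  shows "y = x"
proof (rule ccontr)
  assume "y \<noteq> x"
  have "x \<in> profiles K" "y \<in> profiles K"
    using assms by (auto simp: nash_iff_variational)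
  then have "game_map F y \<bullet> (y - x) > 0" "game_map F y \<bullet> (x - y) \<ge> 0"
    using monotone_at_nash[OF assms(1) _ \<open>y \<noteq> x\<close>] variational_sum[OF assms(2)] by blast+
  then show False
    by (simp add: inner_diff_right)
qed

end

section \<open>Runs of the gossip algorithm\<close>

lemma pair_average_commute: "pair_average (a, b) v = pair_average (b, a) v"
  by (auto simp: pair_average_def vec_eq_iff add.commute)

lemma sum_pair_average_inside:
  fixes v :: "real ^ 'n ^ 'p::finite"
  assumes "a \<in> A \<longleftrightarrow> b \<in> A"
  shows "(\<Sum>i\<in>A. pair_average (a, b) v $ i) = (\<Sum>i\<in>A. v $ i)"
proof (cases "a \<in> A \<and> a \<noteq> b")
  case True
  then have A: "A = insert a (insert b (A - {a, b}))" "a \<noteq> b"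
    using assms by auto
  have rest: "(\<Sum>i\<in>A - {a, b}. pair_average (a, b) v $ i) = (\<Sum>i\<in>A - {a, b}. v $ i)"
    by (rule sum.cong) (auto simp: pair_average_def)
  have split: "sum g A = g a + g b + sum g (A - {a, b})" for g :: "'p \<Rightarrow> real ^ 'n"
    by (subst A(1)) (simp add: A(2) add.assoc)
  have "pair_average (a, b) v $ a + pair_average (a, b) v $ b = v $ a + v $ b"
    using pair_average_nth[of "(a, b)" v] scaleR_half_double[of "v $ a + v $ b"]
    by (simp only: fst_conv snd_conv scaleR_add_right[symmetric])
  with rest show ?thesis
    by (simp only: split)
next
  case False
  then have "a \<notin> A \<and> b \<notin> A \<or> a = b"
    using assms by blast
  then show ?thesis
    by (intro sum.cong refl) (auto simp: pair_average_fixed, auto simp: pair_average_def)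
qed

text \<open>Half the estimate of \<open>b\<close> enters the group and half that of \<open>a\<close>
  leaves it, so the deviation is the mean of those of \<open>insert b A\<close> and
  \<open>A - {a}\<close>. Decisions are not averaged, whence the last term.\<close>

lemma sum_pair_average_across:
  fixes v x :: "real ^ 'n ^ 'p::finite"
  assumes "a \<in> A" "b \<notin> A"
  shows "(\<Sum>i\<in>A. (pair_average (a, b) v - x) $ i) =
    (1 / 2) *\<^sub>R ((\<Sum>i\<in>insert b A. (v - x) $ i) + (\<Sum>i\<in>A - {a}. (v - x) $ i)) + (1 / 2) *\<^sub>R (x $ b - x $ a)"
proof -
  define S where "S = (\<Sum>i\<in>A - {a}. (v - x) $ i)"
  have split: "sum g A = g a + sum g (A - {a})" for g :: "'p \<Rightarrow> real ^ 'n"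
    using assms by (intro sum.remove) auto
  have rest: "(\<Sum>i\<in>A - {a}. (pair_average (a, b) v - x) $ i) = S"
    unfolding S_def using assms by (intro sum.cong refl) (auto simp: pair_average_def)
  have "(pair_average (a, b) v - x) $ a = (1 / 2) *\<^sub>R (v $ a + v $ b) - x $ a"
    using pair_average_nth(1)[of "(a, b)" v] by simp
  then have lhs: "(\<Sum>i\<in>A. (pair_average (a, b) v - x) $ i) = (1 / 2) *\<^sub>R (v $ a + v $ b) - x $ a + S"
    by (simp only: split rest)
  have "(\<Sum>i\<in>insert b A. (v - x) $ i) = (v $ b - x $ b) + ((v $ a - x $ a) + S)"
    using assms by (subst sum.insert) (auto simp: split S_def)
  then have "(1 / 2) *\<^sub>R ((\<Sum>i\<in>insert b A. (v - x) $ i) + S) + (1 / 2) *\<^sub>R (x $ b - x $ a)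
     = (1 / 2) *\<^sub>R ((v $ b - x $ b) + ((v $ a - x $ a) + S) + S + (x $ b - x $ a))"
    by (simp only: scaleR_add_right)
  also have "(v $ b - x $ b) + ((v $ a - x $ a) + S) + S + (x $ b - x $ a)
     = (v $ a + v $ b) + ((S - x $ a) + (S - x $ a))"
    by simp
  also have "(1 / 2) *\<^sub>R \<dots> = (1 / 2) *\<^sub>R (v $ a + v $ b) + (S - x $ a)"
    by (simp only: scaleR_add_right[of _ "v $ a + v $ b"] scaleR_half_double)
  finally show ?thesis
    unfolding lhs S_def by (simp add: algebra_simps)
qed

text \<open>
  A contact conserves the deviation of every group of agents that it does not split. The bound
  is concave in the size of the group, with the curvature that compensates the
  defect \<open>(x $ b - x $ a) / 2\<close> of a contact that splits the group.
\<close>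

lemma deviation_bound_step:
  fixes v x :: "real ^ 'n ^ 'p::finite"
  assumes bound: "\<And>A. norm (\<Sum>i\<in>A. (v - x) $ i) \<le> R / 2 * (real (card A) * real (card (- A)))"
    and R: "\<And>i j. norm (x $ i - x $ j) \<le> R"
  shows "norm (\<Sum>i\<in>A. (pair_average e v - x) $ i) \<le> R / 2 * (real (card A) * real (card (- A)))"
proof -
  have across: "norm (\<Sum>i\<in>A. (pair_average (a, b) v - x) $ i) \<le> R / 2 * (real (card A) * real (card (- A)))"
    if ab: "a \<in> A" "b \<notin> A" for a b
  proof -
    define m where "m = card (A - {a})"
    define n where "n = card (- insert b A)"
    have compl: "- A = insert b (- insert b A)" "- (A - {a}) = insert a (- A)"
      using ab by auto
    have A: "card A = Suc m"
      using ab(1) card_Suc_Diff1[of A a] by (simp add: m_def)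
    have A': "card (- A) = Suc n"
      unfolding compl(1) n_def by simp
    have card: "card (insert b A) = Suc (Suc m)" "card (- (A - {a})) = Suc (Suc n)"
      using ab A A' by (simp_all add: compl(2))
    have "norm (\<Sum>i\<in>A. (pair_average (a, b) v - x) $ i)
        \<le> (1 / 2) * norm ((\<Sum>i\<in>insert b A. (v - x) $ i) + (\<Sum>i\<in>A - {a}. (v - x) $ i))
          + (1 / 2) * norm (x $ b - x $ a)"
      unfolding sum_pair_average_across[OF ab] by (rule norm_triangle_le) simp
    also have "\<dots> \<le> (1 / 2) * (R / 2 * (real (Suc (Suc m)) * real n) + R / 2 * (real m * real (Suc (Suc n)))) + (1 / 2) * R"
      using norm_triangle_mono[OF bound[of "insert b A"] bound[of "A - {a}"]] R[of b a]
      unfolding card m_def[symmetric] n_def[symmetric] by (intro add_mono mult_left_mono) auto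
    \<comment> \<open>The mean of \<open>(m + 2) * n\<close> and \<open>m * (n + 2)\<close> is
      \<open>(m + 1) * (n + 1) - 1\<close>; the missing \<open>1\<close>, scaled by
      \<open>R / 2\<close>, is what the defect adds.\<close>
    also have "\<dots> = R / 2 * (real (Suc m) * real (Suc n))"
      by (simp add: field_simps)
    finally show ?thesis
      by (simp only: A A')
  qed
  obtain a b where e: "e = (a, b)"
    by (cases e)
  show ?thesis
  proof (cases "a \<in> A \<longleftrightarrow> b \<in> A")
    case True
    then show ?thesis
      using bound[of A] sum_pair_average_inside[OF True, of v] by (simp add: e sum_subtractf)
  next
    case False
    then show ?thesis
      using across[of a b] across[of b a] unfolding e pair_average_commute[of b a] by blast
  qed
qed

section \<open>Mean profiles, step counts and continuity near a compact set\<close>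

lemma aggregate_add: "aggregate (x + y) = aggregate x + aggregate y"
  by (simp add: aggregate_def sum.distrib)

lemma aggregate_diff: "aggregate (x - y) = aggregate x - aggregate y"
  by (simp add: aggregate_def sum_subtractf)

text \<open>The orthogonal projection onto the profiles in which all agents agree.\<close>

definition mean_profile :: "real ^ 'n ^ 'p::finite \<Rightarrow> real ^ 'n ^ 'p" where
  "mean_profile x = (\<chi> i. (1 / real CARD('p)) *\<^sub>R aggregate x)"

lemma pair_average_mean_profile: "pair_average e (mean_profile x) = mean_profile x"
  by (simp add: pair_average_def mean_profile_def vec_eq_iff scaleR_half_double)

lemma norm_mean_profile_le:
  fixes x :: "real ^ 'n ^ 'p::finite"
  shows "norm (mean_profile x) \<le> real CARD('p) * norm x"
proof -
  define N where "N = real CARD('p)"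
  have "N > 0"
    by (simp add: N_def card_gt_0_iff)
  have "norm (aggregate x) \<le> (\<Sum>i\<in>UNIV. norm (x $ i))"
    unfolding aggregate_def by (rule norm_sum)
  also have "\<dots> \<le> (\<Sum>i\<in>(UNIV::'p set). norm x)"
    by (intro sum_mono Finite_Cartesian_Product.norm_nth_le)
  finally have agg: "norm (aggregate x) \<le> N * norm x"
    by (simp add: N_def)
  have "norm (mean_profile x) \<le> (\<Sum>i\<in>UNIV. norm (mean_profile x $ i))"
    by (rule norm_vec_le_sum)
  also have "\<dots> = norm (aggregate x)"
    using \<open>N > 0\<close> by (simp add: mean_profile_def N_def)
  finally show ?thesis
    using agg by (simp add: N_def)
qed

lemma mean_profile_diff: "mean_profile (x - y) = mean_profile x - mean_profile y"
  by (simp add: mean_profile_def vec_eq_iff aggregate_diff scaleR_diff_right)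

lemma aggregate_mean_profile:
  fixes x :: "real ^ 'n ^ 'p::finite"
  shows "aggregate (mean_profile x) = aggregate x"
proof -
  have "aggregate (mean_profile x) = (\<Sum>i\<in>(UNIV :: 'p set). (1 / real CARD('p)) *\<^sub>R aggregate x)"
    by (simp add: mean_profile_def aggregate_def[of "vec_lambda _"])
  then show ?thesis
    by (simp only: sum_constant_scaleR) simp
qed

lemma norm_diff_square:
  fixes a b :: "'a::real_inner"
  shows "(norm (a - b))\<^sup>2 = (norm a)\<^sup>2 - 2 * (a \<bullet> b) + (norm b)\<^sup>2"
  by (simp add: power2_norm_eq_inner inner_diff inner_commute[of b a])

text \<open>At the times where \<open>P\<close> holds, \<open>G (Suc t)\<close> runs through
  consecutive integers, each once, so the sum is a stretch of the harmonic series.\<close>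

lemma sum_inverse_count:
  fixes P :: "nat \<Rightarrow> bool"
  defines "G \<equiv> \<lambda>n. \<Sum>t<n. of_bool (P t) :: nat"
  assumes "k \<le> n"
  shows "(\<Sum>t = k..<n. if P t then 1 / real (G (Suc t)) else 0) = harm (G n) - harm (G k)"
  using assms(2)
proof (induction n rule: dec_induct)
  case (step n)
  have "(\<Sum>t = k..<Suc n. if P t then 1 / real (G (Suc t)) else 0)
     = harm (G n) - harm (G k) + (if P n then 1 / real (G (Suc n)) else 0)"
    using step by simp
  also have "\<dots> = harm (G (Suc n)) - harm (G k)"
  proof -
    have "G (Suc n) = G n + of_bool (P n)"
      unfolding G_def by (rule sum.lessThan_Suc)
    then show ?thesis
      by (simp add: harm_Suc inverse_eq_divide)
  qed
  finally show ?case .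
qed simp

text \<open>\<open>G n / n\<close> has a positive limit, so its inverses are bounded. Where the
  count is still \<open>0\<close>, division by zero gives \<open>0\<close> and the bound holds
  too.\<close>

lemma inverse_count_bound:
  fixes G :: "nat \<Rightarrow> nat"
  assumes freq: "(\<lambda>n. real (G n) / real n) \<longlonglongrightarrow> \<pi>" and \<pi>: "\<pi> > 0"
  obtains A where "A \<ge> 0" "\<And>t. 1 / real (G (Suc t)) \<le> A / (real t + 1)"
proof -
  have "(\<lambda>n. inverse (real (G n) / real n)) \<longlonglongrightarrow> inverse \<pi>"
    using \<pi> by (intro tendsto_intros freq) auto
  then have "Bseq (\<lambda>n. inverse (real (G n) / real n))"
    by (intro convergent_imp_Bseq convergentI)
  then obtain A where A: "A > 0" "\<And>n. norm (inverse (real (G n) / real n)) \<le> A"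
    by (rule BseqE) blast
  have "1 / real (G (Suc t)) \<le> A / (real t + 1)" for t
  proof -
    have "1 / real (G (Suc t)) = inverse (real (G (Suc t)) / real (Suc t)) / real (Suc t)"
      by (simp del: of_nat_Suc)
    also have "\<dots> \<le> A / real (Suc t)"
      using A(2)[of "Suc t"] by (intro divide_right_mono) (auto dest: abs_le_D1)
    finally show ?thesis
      by (simp add: add.commute)
  qed
  with A(1) show ?thesis
    by (intro that[of A]) auto
qed

text \<open>Only \<open>p\<close> is confined to \<open>C\<close>. A Lebesgue number of the cover by
  balls of pointwise continuity gives one \<open>\<delta>\<close> for all of
  \<open>C\<close>.\<close>

lemma continuous_near_compact:
  fixes g :: "'a::heine_borel \<Rightarrow> 'b::metric_space"
  assumes C: "compact C" "C \<subseteq> W" and W: "open W" and g: "continuous_on W g" and "\<epsilon> > 0"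
  obtains \<delta> where "\<delta> > 0" "\<And>p q. p \<in> C \<Longrightarrow> dist q p < \<delta> \<Longrightarrow> dist (g q) (g p) < \<epsilon>"
proof -
  have "\<exists>d>0. \<forall>q. dist q p < d \<longrightarrow> dist (g q) (g p) < \<epsilon> / 2" if "p \<in> C" for p
  proof -
    have "isCont g p"
      using g W C that by (auto simp: continuous_on_eq_continuous_at)
    then show ?thesis
      using \<open>\<epsilon> > 0\<close> unfolding continuous_at_eps_delta by (meson half_gt_zero)
  qed
  then obtain d where d: "\<And>p. p \<in> C \<Longrightarrow> d p > 0"
    "\<And>p q. p \<in> C \<Longrightarrow> dist q p < d p \<Longrightarrow> dist (g q) (g p) < \<epsilon> / 2"
    by metis
  have "C \<subseteq> \<Union> ((\<lambda>p. ball p (d p)) ` C)"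
    using d(1) by force
  then obtain \<delta> where \<delta>: "\<delta> > 0"
    "\<And>p. p \<in> C \<Longrightarrow> \<exists>B\<in>(\<lambda>p. ball p (d p)) ` C. ball p \<delta> \<subseteq> B"
    by (rule Heine_Borel_lemma[OF C(1)]) auto
  show ?thesis
  proof (rule that[OF \<delta>(1)])
    fix p q assume p: "p \<in> C" and q: "dist q p < \<delta>"
    obtain r where r: "r \<in> C" "ball p \<delta> \<subseteq> ball r (d r)"
      using \<delta>(2)[OF p] by blast
    have "p \<in> ball p \<delta>" "q \<in> ball p \<delta>"
      using q \<delta>(1) by (simp_all add: dist_commute)
    then have "p \<in> ball r (d r)" "q \<in> ball r (d r)"
      using r(2) by blast+
    then have "dist (g q) (g r) < \<epsilon> / 2" "dist (g p) (g r) < \<epsilon> / 2"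
      using d(2)[OF r(1)] by (simp_all add: dist_commute)
    then show "dist (g q) (g p) < \<epsilon>"
      by (rule dist_triangle_half_l)
  qed
qed

text \<open>A single realised contact sequence: of the randomness only the frequencies
  remain.\<close>

locale gossip_run = aggregative_game K f F U
  for K :: "'p::finite \<Rightarrow> (real ^ 'n) set" and f F U +
  fixes E :: "'p set set" and c :: "nat \<Rightarrow> 'p \<times> 'p" and w :: "('p \<times> 'p) list"
    and q :: real and \<pi> :: "'p \<Rightarrow> real" and x0 :: "real ^ 'n ^ 'p"
  assumes F_bounded: "\<And>i B. bounded B \<Longrightarrow> bounded ((\<lambda>(x, u). F i x u) ` (K i \<times> B))"
    and start: "x0 \<in> profiles K"
    and connected: "connected_graph E"
    and word: "set w = {(i, j). {i, j} \<in> E}" "w \<noteq> []"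
    and word_frequency: "(\<lambda>n. (\<Sum>t<n. of_bool (word_at c w t)) / real n) \<longlonglongrightarrow> q" "q > 0"
    and frequency: "\<And>i. (\<lambda>n. (\<Sum>t<n. of_bool (i \<in> active c t)) / real n) \<longlonglongrightarrow> \<pi> i" "\<And>i. \<pi> i > 0"
begin

definition state where
  "state = gossip K F c (\<lambda>t i. 1 / real (updates c t i)) x0"

definition decision where "decision t = fst (state t)"

definition estimate where "estimate t = snd (state t)"

definition direction where
  "direction t i = F i (decision t $ i) (real CARD('p) *\<^sub>R pair_average (c t) (estimate t) $ i)"

text \<open>Zero for idle agents, so that sums over all agents and times need no case
  distinction.\<close>

definition stepsize where
  "stepsize t i = (if i \<in> active c t then 1 / real (updates c t i) else 0)"

section \<open>A priori bounds along a run\<close>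

lemma K_closed_convex: "closed (K i)" "convex (K i)" "K i \<noteq> {}"
  using K[of i] by (auto intro: compact_imp_closed)

lemma mixed_eq: "mixed c t v i = pair_average (c t) v $ i"
  by (auto simp: mixed_def pair_average_def active_def)

lemma decision_0: "decision 0 = x0" and estimate_0: "estimate 0 = x0"
  by (simp_all add: decision_def estimate_def state_def)

lemma decision_Suc:
  "decision (Suc t) $ i =
    (if i \<in> active c t then closest_point (K i) (decision t $ i - stepsize t i *\<^sub>R direction t i) else decision t $ i)"
  by (simp add: decision_def estimate_def state_def direction_def stepsize_def mixed_eq Let_def case_prod_beta)

lemma estimate_Suc:
  "estimate (Suc t) = pair_average (c t) (estimate t) + (decision (Suc t) - decision t)"
  by (auto simp: vec_eq_iff decision_def estimate_def state_def mixed_eq Let_def case_prod_beta)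
    (auto simp: pair_average_def active_def)

lemma decision_in: "decision t $ i \<in> K i"
proof (induction t)
  case 0
  show ?case
    using start by (simp add: decision_0 profiles_def)
next
  case (Suc t)
  then show ?case
    using closest_point_in_set[OF K_closed_convex(1,3)] by (simp add: decision_Suc)
qed

lemma decision_profiles: "decision t \<in> profiles K"
  using decision_in by (simp add: profiles_def)

text \<open>Averaging conserves the aggregate, and both sequences receive the same
  increment.\<close>

lemma aggregate_estimate: "aggregate (estimate t) = aggregate (decision t)"
  by (induction t)
    (simp_all add: decision_0 estimate_0 estimate_Suc aggregate_add aggregate_diff aggregate_pair_average)

lemma profiles_bound: obtains R where "R \<ge> 0" "\<And>x i. x \<in> profiles K \<Longrightarrow> norm (x $ i) \<le> R"
proof -
  have "bounded (profiles K)"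
    using K by (intro compact_imp_bounded compact_profiles) auto
  then obtain R where R: "\<And>x. x \<in> profiles K \<Longrightarrow> norm x \<le> R"
    by (auto simp: bounded_iff)
  show ?thesis
  proof (rule that)
    show "0 \<le> R"
      using R[OF start] norm_ge_zero[of x0] by linarith
    show "norm (x $ i) \<le> R" if "x \<in> profiles K" for x i
      using order_trans[OF Finite_Cartesian_Product.norm_nth_le R[OF that]] .
  qed
qed

text \<open>The bound must not rest on the directions, whose own bound presupposes bounded
  estimates. The bound on group deviations breaks the circle, as it uses only that the decisions
  stay in the compact sets \<open>K i\<close>; singleton groups then control each component.\<close>

lemma estimate_bound: obtains B where "B \<ge> 0" "\<And>t. norm (estimate t) \<le> B"
proof -
  obtain R where R: "R \<ge> 0" "\<And>x i. x \<in> profiles K \<Longrightarrow> norm (x $ i) \<le> R"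
    by (rule profiles_bound) blast
  have dist: "norm (decision t $ i - decision t $ j) \<le> 2 * R" for t i j
    using norm_triangle_ineq4[of "decision t $ i" "decision t $ j"] R(2)[OF decision_profiles[of t], of i]
      R(2)[OF decision_profiles[of t], of j] by linarith
  have deviation: "norm (\<Sum>i\<in>A. (estimate t - decision t) $ i) \<le> 2 * R / 2 * (real (card A) * real (card (- A)))" for A t
  proof (induction t arbitrary: A)
    case 0
    show ?case
      using R(1) by (simp add: decision_0 estimate_0)
  next
    case (Suc t)
    \<comment> \<open>The new increment enters estimate and decision alike and cancels in the
      deviation.\<close>
    have "estimate (Suc t) - decision (Suc t) = pair_average (c t) (estimate t) - decision t"
      by (simp add: estimate_Suc)
    with deviation_bound_step[OF Suc dist, where A = A and e = "c t"] show ?case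
      by (simp only:)
  qed
  define N where "N = real CARD('p)"
  have component: "norm (estimate t $ i) \<le> R * N + R" for t i
  proof -
    have "real (card (- {i})) \<le> N"
      unfolding N_def by (intro of_nat_mono card_mono) auto
    then have "R * real (card (- {i})) \<le> R * N"
      using R(1) by (rule mult_left_mono)
    with deviation[where A = "{i}" and t = t] have "norm (estimate t $ i - decision t $ i) \<le> R * N"
      by simp
    with norm_triangle_sub[of "estimate t $ i" "decision t $ i"] R(2)[OF decision_profiles[of t], of i]
    show ?thesis
      by linarith
  qed
  show ?thesis
  proof (rule that)
    show "0 \<le> N * (R * N + R)"
      using R(1) by (simp add: N_def)
    show "norm (estimate t) \<le> N * (R * N + R)" for t
      using order_trans[OF norm_vec_le_sum sum_mono[OF component]] by (simp add: N_def)
  qed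
qed

lemma direction_bound: obtains C where "C \<ge> 0" "\<And>t i. norm (direction t i) \<le> C"
proof -
  obtain B where B: "B \<ge> 0" "\<And>t. norm (estimate t) \<le> B"
    by (rule estimate_bound) blast
  define D where "D = real CARD('p) * B"
  have "norm (real CARD('p) *\<^sub>R pair_average (c t) (estimate t) $ i) \<le> D" for t i
  proof -
    have "norm (pair_average (c t) (estimate t) $ i) \<le> B"
      using Finite_Cartesian_Product.norm_nth_le norm_pair_average_le B(2) by (meson order_trans)
    then show ?thesis
      by (simp add: D_def mult_left_mono)
  qed
  then have arg: "(decision t $ i, real CARD('p) *\<^sub>R pair_average (c t) (estimate t) $ i) \<in> K i \<times> cball 0 D" for t i
    using decision_in[of t i] by simp
  have "\<exists>C. \<forall>z\<in>(\<lambda>(x, u). F i x u) ` (K i \<times> cball 0 D). norm z \<le> C" for i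
    using F_bounded[OF bounded_cball[of 0 D], of i] unfolding bounded_iff .
  then obtain C where C: "\<And>i z. z \<in> (\<lambda>(x, u). F i x u) ` (K i \<times> cball 0 D) \<Longrightarrow> norm z \<le> C i"
    by metis
  have C': "norm (direction t i) \<le> C i" for t i
    using C[OF imageI[OF arg[of t i]]] by (simp add: direction_def)
  have C_nonneg: "0 \<le> C i" for i
    using norm_ge_zero C'[of 0 i] by (rule order_trans)
  show ?thesis
  proof (rule that)
    show "0 \<le> (\<Sum>i\<in>UNIV. C i)"
      using C_nonneg by (simp add: sum_nonneg)
    show "norm (direction t i) \<le> (\<Sum>i\<in>UNIV. C i)" for t i
      using C'[of t i] member_le_sum[of i UNIV C] C_nonneg by (meson UNIV_I finite order_trans)
  qed
qed

section \<open>Step sizes and increments of the decisions\<close>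

lemma updates_eq: "updates c t i = (\<Sum>s<Suc t. of_bool (i \<in> active c s))"
  by (simp add: updates_def Int_def less_Suc_eq_le del: sum.lessThan_Suc)

lemma stepsize_nonneg: "stepsize t i \<ge> 0"
  by (simp add: stepsize_def)

lemma count_frequency: "(\<lambda>n. real (\<Sum>t<n. of_bool (i \<in> active c t)) / real n) \<longlonglongrightarrow> \<pi> i"
  using frequency(1)[of i] by (simp only: of_nat_sum of_nat_of_bool)

lemma stepsize_bound: obtains A where "A \<ge> 0" "\<And>t i. stepsize t i \<le> A / (real t + 1)"
proof -
  have "\<forall>i. \<exists>A\<ge>0. \<forall>t. 1 / real (updates c t i) \<le> A / (real t + 1)"
  proof
    fix i
    show "\<exists>A\<ge>0. \<forall>t. 1 / real (updates c t i) \<le> A / (real t + 1)"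
      unfolding updates_eq by (rule inverse_count_bound[OF count_frequency frequency(2)]) blast
  qed
  then obtain A where A: "\<And>i. A i \<ge> 0" "\<And>i t. 1 / real (updates c t i) \<le> A i / (real t + 1)"
    by metis
  show ?thesis
  proof (rule that)
    show "0 \<le> (\<Sum>i\<in>UNIV. A i)"
      using A(1) by (simp add: sum_nonneg)
    fix t i
    have "stepsize t i \<le> A i / (real t + 1)"
      using A(1)[of i] A(2)[where i = i and t = t] by (simp add: stepsize_def)
    also have "\<dots> \<le> (\<Sum>i\<in>UNIV. A i) / (real t + 1)"
      using A(1) by (intro divide_right_mono member_le_sum) auto
    finally show "stepsize t i \<le> (\<Sum>i\<in>UNIV. A i) / (real t + 1)" .
  qed
qed

text \<open>The frequency \<open>\<pi> i\<close> drops out, so all agents spend asymptotically the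
  same total step length in a window, as the Lyapunov argument requires.\<close>

lemma stepsize_total:
  assumes "r > 0"
  shows "(\<lambda>n. \<Sum>t = window_start r n..<n. stepsize t i) \<longlonglongrightarrow> ln (1 + r)"
  using harm_window_tendsto[OF count_frequency frequency(2) assms, of i]
  unfolding stepsize_def updates_eq
  by (subst sum_inverse_count[OF window_start_bounds(1)[OF less_imp_le[OF assms]]])

text \<open>Projections are nonexpansive and fix \<open>y\<close>. Taking the current decision for
  \<open>y\<close> bounds the increments, taking the equilibrium gives the descent.\<close>

lemma projection_step:
  assumes "y \<in> K i"
  shows "norm (decision (Suc t) $ i - y) \<le> norm (decision t $ i - y - stepsize t i *\<^sub>R direction t i)"
proof (cases "i \<in> active c t")
  case True
  have "dist (closest_point (K i) (decision t $ i - stepsize t i *\<^sub>R direction t i)) (closest_point (K i) y)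
      \<le> dist (decision t $ i - stepsize t i *\<^sub>R direction t i) y"
    by (intro closest_point_lipschitz K_closed_convex)
  then show ?thesis
    using True closest_point_self[OF assms]
    by (simp add: decision_Suc dist_norm algebra_simps)
next
  case False
  then show ?thesis
    by (simp add: decision_Suc stepsize_def)
qed

lemma decision_increment: obtains A where "A \<ge> 0" "\<And>t. norm (decision (Suc t) - decision t) \<le> A / (real t + 1)"
proof -
  obtain A where A: "A \<ge> 0" "\<And>t i. stepsize t i \<le> A / (real t + 1)"
    by (rule stepsize_bound) blast
  obtain C where C: "C \<ge> 0" "\<And>t i. norm (direction t i) \<le> C"
    by (rule direction_bound) blast
  define N where "N = real CARD('p)"
  have component: "norm ((decision (Suc t) - decision t) $ i) \<le> A / (real t + 1) * C" for t i
  proof -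
    have "norm (decision (Suc t) $ i - decision t $ i) \<le> stepsize t i * norm (direction t i)"
      using projection_step[OF decision_in[of t i], of t] stepsize_nonneg[of t i] by simp
    also have "\<dots> \<le> A / (real t + 1) * C"
      using A C stepsize_nonneg by (intro mult_mono) auto
    finally show ?thesis
      by simp
  qed
  show ?thesis
  proof (rule that)
    show "0 \<le> N * A * C"
      using A(1) C(1) by (simp add: N_def)
    show "norm (decision (Suc t) - decision t) \<le> N * A * C / (real t + 1)" for t
      using order_trans[OF norm_vec_le_sum sum_mono[OF component[of t]]] by (simp add: N_def mult_ac)
  qed
qed

text \<open>Averaging fixes the mean profile, so the disagreement evolves by pure averaging up to
  the increment minus its mean, which is of order \<open>1 / t\<close>.\<close>

lemma estimate_consensus: "(\<lambda>t. estimate t - mean_profile (decision t)) \<longlonglongrightarrow> 0"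
proof -
  define N where "N = real CARD('p)"
  obtain A where A: "A \<ge> 0" "\<And>t. norm (decision (Suc t) - decision t) \<le> A / (real t + 1)"
    by (rule decision_increment) blast
  obtain B where B: "B \<ge> 0" "\<And>t. norm (estimate t) \<le> B"
    by (rule estimate_bound) blast
  have mean: "mean_profile (estimate t) = mean_profile (decision t)" for t
    by (simp add: mean_profile_def aggregate_estimate)
  have norm_le: "norm (y - mean_profile y) \<le> (1 + N) * norm y" for y :: "real ^ 'n ^ 'p"
    using norm_triangle_ineq4[of y "mean_profile y"] norm_mean_profile_le[of y]
    by (simp add: N_def distrib_right)
  show ?thesis
  proof (rule consensus_tendsto_zero[OF connected word word_frequency])
    fix t
    show "aggregate (estimate t - mean_profile (decision t)) = 0"
      by (simp add: aggregate_diff aggregate_mean_profile aggregate_estimate)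
    have "(1 + N) * norm (estimate t) \<le> (1 + N) * B"
      using B(2) by (intro mult_left_mono) (auto simp: N_def)
    then show "norm (estimate t - mean_profile (decision t)) \<le> (1 + N) * B"
      using norm_le[of "estimate t"] by (simp only: mean)
    show "0 \<le> (1 + N) * A"
      using A(1) by (simp add: N_def)
    have "estimate (Suc t) - mean_profile (decision (Suc t)) - pair_average (c t) (estimate t - mean_profile (decision t))
        = (decision (Suc t) - decision t) - mean_profile (decision (Suc t) - decision t)"
      by (simp add: estimate_Suc linear_diff[OF linear_pair_average] pair_average_mean_profile mean_profile_diff)
    also have "norm \<dots> \<le> (1 + N) * norm (decision (Suc t) - decision t)"
      by (rule norm_le)
    also have "\<dots> \<le> (1 + N) * (A / (real t + 1))"
      using A(2) by (intro mult_left_mono) (auto simp: N_def)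
    finally show "norm (estimate (Suc t) - mean_profile (decision (Suc t)) -
        pair_average (c t) (estimate t - mean_profile (decision t))) \<le> (1 + N) * A / (real t + 1)"
      by simp
  qed
qed

lemma estimate_tracks_aggregate:
  "(\<lambda>t. real CARD('p) *\<^sub>R pair_average (c t) (estimate t) $ i - aggregate (decision t)) \<longlonglongrightarrow> 0"
proof -
  define N where "N = real CARD('p)"
  define z where "z t = estimate t - mean_profile (decision t)" for t
  have eq: "N *\<^sub>R pair_average (c t) (estimate t) $ i - aggregate (decision t) = N *\<^sub>R pair_average (c t) (z t) $ i" for t
    by (simp add: z_def linear_diff[OF linear_pair_average] pair_average_mean_profile scaleR_diff_right)
      (simp add: mean_profile_def N_def)
  have "norm (N *\<^sub>R pair_average (c t) (z t) $ i) \<le> N * norm (z t)" for t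
  proof -
    have "norm (pair_average (c t) (z t) $ i) \<le> norm (z t)"
      using Finite_Cartesian_Product.norm_nth_le norm_pair_average_le by (rule order_trans)
    then show ?thesis
      by (simp add: N_def mult_left_mono)
  qed
  then have "eventually (\<lambda>t. norm (N *\<^sub>R pair_average (c t) (z t) $ i) \<le> N * norm (z t)) sequentially"
    by simp
  moreover have "(\<lambda>t. N * norm (z t)) \<longlonglongrightarrow> 0"
    using tendsto_mult_right_zero[OF tendsto_norm_zero[OF estimate_consensus], of N] by (simp add: z_def)
  ultimately have "(\<lambda>t. N *\<^sub>R pair_average (c t) (z t) $ i) \<longlonglongrightarrow> 0"
    by (rule Lim_null_comparison)
  then show ?thesis
    by (simp only: eq[symmetric]) (simp only: N_def)
qed

text \<open>The scaled estimate may lie outside \<open>aggregates K\<close> but approaches the true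
  aggregate, so continuity of \<open>F i\<close> near the compact set applies, uniformly over the
  moving decisions.\<close>

lemma direction_tends_to_game_map: "(\<lambda>t. norm (direction t i - game_map F (decision t) $ i)) \<longlonglongrightarrow> 0"
proof (rule tendstoI)
  fix \<epsilon> :: real assume "\<epsilon> > 0"
  have comp: "compact (K i \<times> aggregates K)"
    unfolding aggregates_def using K
    by (intro compact_Times compact_continuous_image continuous_on_aggregate compact_profiles) auto
  have "K i \<times> aggregates K \<subseteq> U i" "open (U i)"
    using U[of i] by auto
  from continuous_near_compact[OF comp this F_continuous \<open>\<epsilon> > 0\<close>]
  obtain \<delta> where \<delta>: "\<delta> > 0" "\<And>p q. p \<in> K i \<times> aggregates K \<Longrightarrow> dist q p < \<delta> \<Longrightarrow>
      dist (case q of (x, u) \<Rightarrow> F i x u) (case p of (x, u) \<Rightarrow> F i x u) < \<epsilon>"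
    by blast
  have "eventually (\<lambda>t. dist (real CARD('p) *\<^sub>R pair_average (c t) (estimate t) $ i - aggregate (decision t)) 0 < \<delta>) sequentially"
    using estimate_tracks_aggregate \<delta>(1) by (rule tendstoD)
  then show "eventually (\<lambda>t. dist (norm (direction t i - game_map F (decision t) $ i)) 0 < \<epsilon>) sequentially"
  proof eventually_elim
    case (elim t)
    let ?u = "real CARD('p) *\<^sub>R pair_average (c t) (estimate t) $ i"
    have "(decision t $ i, aggregate (decision t)) \<in> K i \<times> aggregates K"
      using decision_in[of t i] decision_profiles[of t] by (simp add: aggregates_def)
    moreover have "dist (decision t $ i, ?u) (decision t $ i, aggregate (decision t)) < \<delta>"
      using elim by (simp add: dist_Pair_Pair dist_norm)
    ultimately show ?case
      using \<delta>(2)[of "(decision t $ i, aggregate (decision t))" "(decision t $ i, ?u)"]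
      by (simp add: direction_def game_map_def dist_norm)
  qed
qed

text \<open>The squared distance to the equilibrium is the Lyapunov function: the \<open>h i\<close>
  sum to twice the pairing that \<open>monotone_at_nash\<close> makes positive.\<close>

lemma decision_tendsto_nash:
  assumes nash: "nash_equilibrium K f xs"
  shows "decision \<longlonglongrightarrow> xs"
proof -
  have xs: "xs \<in> profiles K"
    using nash by (simp add: nash_iff_variational)
  obtain R where R: "R \<ge> 0" "\<And>x i. x \<in> profiles K \<Longrightarrow> norm (x $ i) \<le> R"
    by (rule profiles_bound) blast
  obtain A where A: "A \<ge> 0" "\<And>t i. stepsize t i \<le> A / (real t + 1)"
    by (rule stepsize_bound) blast
  obtain C where C: "C \<ge> 0" "\<And>t i. norm (direction t i) \<le> C"
    by (rule direction_bound) blast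
  obtain A' where A': "A' \<ge> 0" "\<And>t. norm (decision (Suc t) - decision t) \<le> A' / (real t + 1)"
    by (rule decision_increment) blast
  define V where "V y = (norm (y - xs))\<^sup>2" for y
  define h where "h i y = 2 * (game_map F y $ i \<bullet> (y $ i - xs $ i))" for i y
  define err where "err t i = norm (direction t i - game_map F (decision t) $ i)" for t i
  \<comment> \<open>One factor \<open>1 / (t + 1)\<close> is split off. The first summand is the
    direction error, where \<open>4 * R\<close> is twice the bound \<open>2 * R\<close> on the
    distance to the equilibrium component; the second is the squared step.\<close>
  define \<beta> where "\<beta> t = (\<Sum>i\<in>UNIV. A * (4 * R * err t i) + A\<^sup>2 * C\<^sup>2 / (real t + 1))" for t
  have V_sum: "V y = (\<Sum>i\<in>UNIV. (norm (y $ i - xs $ i))\<^sup>2)" for y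
    by (simp add: V_def power2_norm_eq_inner inner_vec_def[of "y - xs"])
  have "(\<lambda>t. 1 / (real t + 1)) \<longlonglongrightarrow> 0"
    using LIMSEQ_Suc[OF lim_1_over_n] by (simp add: add.commute)
  from tendsto_mult_right_zero[OF this, of "A\<^sup>2 * C\<^sup>2"] have sq: "(\<lambda>t. A\<^sup>2 * C\<^sup>2 / (real t + 1)) \<longlonglongrightarrow> 0"
    by simp
  have "\<beta> \<longlonglongrightarrow> (\<Sum>i\<in>(UNIV :: 'p set). A * (4 * R * 0) + 0)"
    unfolding \<beta>_def err_def by (intro tendsto_intros direction_tends_to_game_map sq)
  then have \<beta>: "\<beta> \<longlonglongrightarrow> 0"
    by simp
  have descent: "V (decision (Suc t)) \<le> V (decision t) - (\<Sum>i\<in>UNIV. stepsize t i * h i (decision t)) + \<beta> t / (real t + 1)" for t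
  proof -
    have component: "(norm (decision (Suc t) $ i - xs $ i))\<^sup>2 \<le>
        (norm (decision t $ i - xs $ i))\<^sup>2 - stepsize t i * h i (decision t)
          + (A * (4 * R * err t i) + A\<^sup>2 * C\<^sup>2 / (real t + 1)) / (real t + 1)" for i
    proof -
      define d where "d = decision t $ i - xs $ i"
      define s where "s = stepsize t i"
      define g where "g = direction t i"
      define G where "G = game_map F (decision t) $ i"
      have s: "0 \<le> s" "s \<le> A / (real t + 1)"
        using stepsize_nonneg A(2) by (auto simp: s_def)
      have d: "norm d \<le> 2 * R"
        unfolding d_def using norm_triangle_ineq4[of "decision t $ i" "xs $ i"]
          R(2)[OF decision_profiles[of t], of i] R(2)[OF xs, of i] by linarith
      have err: "norm (g - G) = err t i"
        by (simp only: err_def g_def G_def)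
      have "norm (decision (Suc t) $ i - xs $ i) \<le> norm (d - s *\<^sub>R g)"
        unfolding d_def s_def g_def using xs by (intro projection_step) (simp add: profiles_def)
      then have "(norm (decision (Suc t) $ i - xs $ i))\<^sup>2 \<le> (norm (d - s *\<^sub>R g))\<^sup>2"
        by (rule power_mono) simp
      also have "\<dots> = (norm d)\<^sup>2 - 2 * (d \<bullet> (s *\<^sub>R g)) + (norm (s *\<^sub>R g))\<^sup>2"
        by (rule norm_diff_square)
      \<comment> \<open>The direction \<open>g\<close> in use is replaced by the component
        \<open>G\<close> of the game map, at the price of the error \<open>g - G\<close>.\<close>
      also have "d \<bullet> (s *\<^sub>R g) = s * (G \<bullet> d) - s * (- ((g - G) \<bullet> d))"
        by (simp add: inner_commute[of d] inner_diff_left right_diff_distrib)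
      finally have expand: "(norm (decision (Suc t) $ i - xs $ i))\<^sup>2 \<le>
          (norm d)\<^sup>2 - 2 * (s * (G \<bullet> d) - s * (- ((g - G) \<bullet> d))) + (norm (s *\<^sub>R g))\<^sup>2" .
      have linear_term: "s * (- ((g - G) \<bullet> d)) \<le> A / (real t + 1) * (err t i * (2 * R))"
      proof -
        have "- ((g - G) \<bullet> d) \<le> norm (g - G) * norm d"
          using Cauchy_Schwarz_ineq2[of "g - G" d] by linarith
        also have "\<dots> \<le> err t i * (2 * R)"
          unfolding err[symmetric] using d by (rule mult_left_mono) simp
        finally have "s * (- ((g - G) \<bullet> d)) \<le> s * (err t i * (2 * R))"
          using s(1) by (rule mult_left_mono)
        also have "\<dots> \<le> A / (real t + 1) * (err t i * (2 * R))"
          using s(2) R(1) by (intro mult_right_mono) (simp_all add: err_def)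
        finally show ?thesis .
      qed
      have square_term: "(norm (s *\<^sub>R g))\<^sup>2 \<le> (A / (real t + 1) * C)\<^sup>2"
      proof (rule power_mono)
        show "norm (s *\<^sub>R g) \<le> A / (real t + 1) * C"
          using mult_mono[OF s(2) C(2)[of t i]] s(1) A(1) by (simp add: g_def)
      qed simp
      have "(norm (decision (Suc t) $ i - xs $ i))\<^sup>2 \<le> (norm d)\<^sup>2 - 2 * (s * (G \<bullet> d))
          + 2 * (A / (real t + 1) * (err t i * (2 * R))) + (A / (real t + 1) * C)\<^sup>2"
      proof -
        have "L \<le> D - 2 * a + 2 * B + B'" if "L \<le> D - 2 * (a - b) + b'" "b \<le> B" "b' \<le> B'"
          for L D a b b' B B' :: real
          using that by simp
        from this[OF expand linear_term square_term] show ?thesis .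
      qed
      also have "2 * (s * (G \<bullet> d)) = stepsize t i * h i (decision t)"
        by (simp add: h_def G_def d_def s_def)
      also have "2 * (A / (real t + 1) * (err t i * (2 * R))) = A * (4 * R * err t i) / (real t + 1)"
        by simp
      also have "(A / (real t + 1) * C)\<^sup>2 = A\<^sup>2 * C\<^sup>2 / (real t + 1) / (real t + 1)"
        by (simp add: power_mult_distrib power_divide) (simp add: power2_eq_square)
      finally show ?thesis
        by (simp only: d_def add_divide_distrib add.assoc)
    qed
    show ?thesis
      unfolding V_sum \<beta>_def sum_divide_distrib sum_subtractf[symmetric] sum.distrib[symmetric]
      by (intro sum_mono component)
  qed
  have V_small: "eventually (\<lambda>t. V (decision t) \<le> \<eta>) sequentially" if "\<eta> > 0" for \<eta>
  proof (rule lyapunov_asynchronous[where S = "profiles K" and A = A' and h = h and a = stepsize and \<beta> = \<beta>])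
    show "compact (profiles K)"
      using K by (intro compact_profiles) auto
    show "continuous_on (profiles K) V"
      unfolding V_def by (intro continuous_intros)
    show "continuous_on (profiles K) (h i)" for i
      unfolding h_def by (intro continuous_intros game_map_continuous)
    show "0 < (\<Sum>i\<in>UNIV. h i y)" if "y \<in> profiles K" "V y > 0" for y
    proof -
      have "(\<Sum>i\<in>UNIV. h i y) = 2 * (game_map F y \<bullet> (y - xs))"
        by (simp add: h_def sum_distrib_left inner_vec_def[of "game_map F y"])
      moreover have "y \<noteq> xs"
        using that(2) by (auto simp: V_def)
      ultimately show ?thesis
        using monotone_at_nash[OF nash that(1)] by simp
    qed
    show "dist (decision (Suc t)) (decision t) \<le> A' / (real t + 1)" for t
      using A'(2) by (simp add: dist_norm)
  qed (use decision_profiles A'(1) stepsize_nonneg stepsize_total \<beta> descent that in auto)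
  show ?thesis
  proof (rule tendstoI)
    fix e :: real assume "e > 0"
    have "eventually (\<lambda>t. V (decision t) \<le> (e / 2)\<^sup>2) sequentially"
      using \<open>e > 0\<close> by (intro V_small) simp
    then show "eventually (\<lambda>t. dist (decision t) xs < e) sequentially"
    proof eventually_elim
      case (elim t)
      then have "norm (decision t - xs) \<le> e / 2"
        unfolding V_def by (rule power2_le_imp_le) (use \<open>e > 0\<close> in simp)
      then show ?case
        using \<open>e > 0\<close> by (simp add: dist_norm)
    qed
  qed
qed

end

section \<open>Almost sure convergence\<close>

text \<open>The contact probabilities are prescribed on edges only. At each initiator the edges
  already exhaust its share \<open>1 / N\<close>, so all other pairs have probability zero.\<close>

lemma gossip_contact_law:
  fixes I J :: "nat \<Rightarrow> 'w \<Rightarrow> 'p::finite"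
  assumes M: "prob_space M" and contacts: "gossip_contacts M E p I J"
  defines "\<mu> \<equiv> \<lambda>(i, j). if j \<in> neighbours E i then p i j / real CARD('p) else 0"
  shows "measure M {\<omega> \<in> space M. (I k \<omega>, J k \<omega>) = e} = \<mu> e"
proof -
  interpret prob_space M
    by (rule M)
  define N where "N = real CARD('p)"
  have N: "N > 0"
    by (simp add: N_def card_gt_0_iff)
  have p_sum: "(\<Sum>j\<in>neighbours E i. p i j) = 1" for i
    using contacts by (simp add: gossip_contacts_def)
  have initiator: "prob {\<omega> \<in> space M. I k \<omega> = i} = 1 / N" for i
    using contacts by (simp add: gossip_contacts_def N_def)
  have [measurable]: "(\<lambda>\<omega>. (I k \<omega>, J k \<omega>)) \<in> measurable M (count_space UNIV)"
    using contacts unfolding gossip_contacts_def indep_vars_def by blast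
  define A where "A i j = {\<omega> \<in> space M. (I k \<omega>, J k \<omega>) = (i, j)}" for i j
  have A_sets: "A i j \<in> events" for i j
    unfolding A_def by measurable
  have edge: "prob (A i j) = p i j / N" if "j \<in> neighbours E i" for i j
  proof -
    have "\<P>(\<omega> in M. J k \<omega> = j \<bar> I k \<omega> = i) = p i j"
      using contacts that by (simp add: gossip_contacts_def)
    then have "prob {\<omega> \<in> space M. J k \<omega> = j \<and> I k \<omega> = i} = p i j / N"
      using N by (simp add: cond_prob_def initiator eq_divide_eq)
    moreover have "{\<omega> \<in> space M. J k \<omega> = j \<and> I k \<omega> = i} = A i j"
      by (auto simp: A_def)
    ultimately show ?thesis
      by simp
  qed
  have total: "(\<Sum>j\<in>UNIV. prob (A i j)) = 1 / N" for i
  proof -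
    have "prob (\<Union>j\<in>UNIV. A i j) = (\<Sum>j\<in>UNIV. prob (A i j))"
      using A_sets by (intro finite_measure_finite_Union) (auto simp: disjoint_family_on_def A_def)
    moreover have "(\<Union>j\<in>UNIV. A i j) = {\<omega> \<in> space M. I k \<omega> = i}"
      by (auto simp: A_def)
    ultimately show ?thesis
      by (simp add: initiator)
  qed
  have no_edge: "prob (A i j) = 0" if "j \<notin> neighbours E i" for i j
  proof -
    have "(\<Sum>j\<in>UNIV. prob (A i j)) = (\<Sum>j\<in>neighbours E i. prob (A i j)) + (\<Sum>j\<in>- neighbours E i. prob (A i j))"
      by (subst sum.union_disjoint[symmetric]) (auto simp: Compl_partition)
    moreover have "(\<Sum>j\<in>neighbours E i. prob (A i j)) = 1 / N"
      using p_sum[of i] by (simp add: edge flip: sum_divide_distrib)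
    ultimately have "(\<Sum>j\<in>- neighbours E i. prob (A i j)) = 0"
      by (simp add: total)
    then show ?thesis
      using that by (subst (asm) sum_nonneg_eq_0_iff) auto
  qed
  obtain i j where "e = (i, j)"
    by (cases e)
  then show ?thesis
    using edge[of j i] no_edge[of j i] by (simp add: \<mu>_def A_def N_def)
qed

theorem proposition3:
  fixes K :: "'p::finite \<Rightarrow> (real ^ 'n) set"
    and f :: "'p \<Rightarrow> real ^ 'n \<Rightarrow> real ^ 'n \<Rightarrow> real"
    and F :: "'p \<Rightarrow> real ^ 'n \<Rightarrow> real ^ 'n \<Rightarrow> real ^ 'n"
    and U :: "'p \<Rightarrow> ((real ^ 'n) \<times> (real ^ 'n)) set"
    and E :: "'p set set"
    and p :: "'p \<Rightarrow> 'p \<Rightarrow> real"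
    and M :: "'w measure"
    and I J :: "nat \<Rightarrow> 'w \<Rightarrow> 'p"
    and x0 :: "'w \<Rightarrow> real ^ 'n ^ 'p"
  assumes players: "CARD('p) \<ge> 2"
    and K: "\<And>i. K i \<noteq> {} \<and> compact (K i) \<and> convex (K i)"
    and U: "\<And>i. open (U i) \<and> K i \<times> aggregates K \<subseteq> U i"
    and f_diff: "\<And>i. continuously_differentiable_over (U i) (\<lambda>(x, u). f i x u)"
    and f_convex: "\<And>i x. x \<in> profiles K \<Longrightarrow>
        convex_on (K i) (\<lambda>z. f i z (z + aggregate_others i x))"
    and F: "\<And>i x u. (x, u) \<in> U i \<Longrightarrow> F i x u = aggregative_grad (f i) x u"
    and F_bounded: "\<And>i B. bounded B \<Longrightarrow> bounded ((\<lambda>(x, u). F i x u) ` (K i \<times> B))"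
    and monotone: "\<And>x y. x \<in> profiles K \<Longrightarrow> y \<in> profiles K \<Longrightarrow> x \<noteq> y \<Longrightarrow>
        (game_map F x - game_map F y) \<bullet> (x - y) > 0"
    and lipschitz: "\<And>i. \<exists>L>0. \<forall>x\<in>K i. \<forall>z1\<in>aggregates K. \<forall>z2\<in>aggregates K.
        norm (F i x z1 - F i x z2) \<le> L * norm (z1 - z2)"
    and graph: "\<And>e. e \<in> E \<Longrightarrow> card e = 2"
    and connected: "connected_graph E"
    and M: "prob_space M"
    and contacts: "gossip_contacts M E p I J"
    and x0: "x0 \<in> borel_measurable M" "\<And>\<omega>. \<omega> \<in> space M \<Longrightarrow> x0 \<omega> \<in> profiles K"
    and x0_indep: "prob_space.indep_set M
        (sets (vimage_algebra (space M) (\<lambda>\<omega> k. (I k \<omega>, J k \<omega>))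
           (\<Pi>\<^sub>M k\<in>(UNIV :: nat set). count_space UNIV)))
        (sets (vimage_algebra (space M) x0 borel))"
  shows "\<exists>xs. nash_equilibrium K f xs \<and> (\<forall>y. nash_equilibrium K f y \<longrightarrow> y = xs) \<and>
    (AE \<omega> in M.
       (\<lambda>k. gossip_decisions K F (\<lambda>t. (I t \<omega>, J t \<omega>))
              (\<lambda>t i. 1 / real (updates (\<lambda>s. (I s \<omega>, J s \<omega>)) t i)) (x0 \<omega>) k)
         \<longlonglongrightarrow> xs)"
proof -
  interpret aggregative_game K f F U
    by unfold_locales (fact K U f_diff f_convex F monotone)+
  interpret prob_space M
    by (rule M)
  obtain xs where xs: "nash_equilibrium K f xs"
    using nash_exists by blast
  define \<mu> where "\<mu> = (\<lambda>(i, j). if j \<in> neighbours E i then p i j / real CARD('p) else 0)"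
  have law: "prob {\<omega> \<in> space M. (I k \<omega>, J k \<omega>) = e} = \<mu> e" for k e
    unfolding \<mu>_def by (rule gossip_contact_law[OF M contacts])
  have indep: "indep_vars (\<lambda>_. count_space UNIV) (\<lambda>k \<omega>. (I k \<omega>, J k \<omega>)) UNIV"
    using contacts by (simp add: gossip_contacts_def)
  have p_pos: "p i j > 0" if "j \<in> neighbours E i" for i j
    using contacts that by (simp add: gossip_contacts_def)
  have \<mu>_pos: "\<mu> (i, j) > 0" if "{i, j} \<in> E" for i j
    using p_pos[of j i] that by (simp add: \<mu>_def neighbours_def card_gt_0_iff)
  \<comment> \<open>The contact probabilities of an isolated agent would form an empty sum, which is
    not \<open>1\<close>.\<close>
  have neighbour: "\<exists>j. {i, j} \<in> E" for i
  proof (rule ccontr)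
    assume "\<not> ?thesis"
    then have "neighbours E i = {}"
      by (simp add: neighbours_def)
    moreover have "(\<Sum>j\<in>neighbours E i. p i j) = 1"
      using contacts by (simp add: gossip_contacts_def)
    ultimately show False
      by simp
  qed
  obtain w where w: "set w = {(i, j). {i, j} \<in> E}"
    using finite_list[of "{(i, j). {i, j} \<in> E}"] by auto
  have w_nonempty: "w \<noteq> []"
    using neighbour w by fastforce
  define q where "q = (\<Prod>t<length w. \<mu> (w ! t))"
  have q: "q > 0"
    unfolding q_def
  proof (intro prod_pos ballI)
    fix t assume "t \<in> {..<length w}"
    then have "w ! t \<in> {(i, j). {i, j} \<in> E}"
      unfolding w[symmetric] by simp
    then show "\<mu> (w ! t) > 0"
      using \<mu>_pos by auto
  qed
  define B where "B i = {e :: 'p \<times> 'p. i \<in> {fst e, snd e}}" for i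
  \<comment> \<open>Agent \<open>i\<close> counts both as initiator and as contacted agent.\<close>
  define \<pi> where "\<pi> i = (\<Sum>e\<in>B i. \<mu> e)" for i
  have [measurable]: "(\<lambda>\<omega>. (I k \<omega>, J k \<omega>)) \<in> measurable M (count_space UNIV)" for k
    using indep unfolding indep_vars_def by blast
  have B_law: "prob {\<omega> \<in> space M. (I k \<omega>, J k \<omega>) \<in> B i} = \<pi> i" for k i
  proof -
    have "prob (\<Union>e\<in>B i. {\<omega> \<in> space M. (I k \<omega>, J k \<omega>) = e}) = \<pi> i"
      unfolding \<pi>_def law[of k, symmetric]
    proof (rule finite_measure_finite_Union)
      show "(\<lambda>e. {\<omega> \<in> space M. (I k \<omega>, J k \<omega>) = e}) ` B i \<subseteq> events"
        by (intro image_subsetI) measurable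
    qed (auto simp: disjoint_family_on_def)
    moreover have "(\<Union>e\<in>B i. {\<omega> \<in> space M. (I k \<omega>, J k \<omega>) = e}) = {\<omega> \<in> space M. (I k \<omega>, J k \<omega>) \<in> B i}"
      by blast
    ultimately show ?thesis
      by simp
  qed
  have \<pi>_pos: "\<pi> i > 0" for i
  proof -
    obtain j where j: "{i, j} \<in> E"
      using neighbour by blast
    show ?thesis
      unfolding \<pi>_def
    proof (rule sum_pos2)
      show "(i, j) \<in> B i" "0 < \<mu> (i, j)"
        using \<mu>_pos[OF j] by (simp_all add: B_def)
      show "0 \<le> \<mu> e" for e
        unfolding law[of 0, symmetric] by (rule measure_nonneg)
    qed simp
  qed
  have "AE \<omega> in M. (\<lambda>n. (\<Sum>t<n. of_bool (word_at (\<lambda>s. (I s \<omega>, J s \<omega>)) w t)) / real n) \<longlonglongrightarrow> q"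
    unfolding q_def by (rule word_frequency_AE[OF indep law w_nonempty])
  moreover have "AE \<omega> in M. \<forall>i\<in>UNIV. (\<lambda>n. (\<Sum>t<n. of_bool ((I t \<omega>, J t \<omega>) \<in> B i)) / real n) \<longlonglongrightarrow> \<pi> i"
    by (intro AE_finite_allI letter_frequency_AE[OF indep B_law]) simp
  moreover note AE_space
  ultimately have "AE \<omega> in M.
       (\<lambda>k. gossip_decisions K F (\<lambda>t. (I t \<omega>, J t \<omega>))
              (\<lambda>t i. 1 / real (updates (\<lambda>s. (I s \<omega>, J s \<omega>)) t i)) (x0 \<omega>) k) \<longlonglongrightarrow> xs"
  proof eventually_elim
    case (elim \<omega>)
    \<comment> \<open>Off a null set both frequency statements hold, and the deterministic analysis
      applies to this one contact sequence.\<close>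
    interpret run: gossip_run K f F U E "\<lambda>t. (I t \<omega>, J t \<omega>)" w q \<pi> "x0 \<omega>"
    proof
      show "(\<lambda>n. (\<Sum>t<n. of_bool (i \<in> active (\<lambda>t. (I t \<omega>, J t \<omega>)) t)) / real n) \<longlonglongrightarrow> \<pi> i" for i
        using elim(2) by (simp add: B_def active_def)
    qed (fact F_bounded x0(2)[OF elim(3)] connected w w_nonempty elim(1) q \<pi>_pos)+
    show ?case
      using run.decision_tendsto_nash[OF xs]
      unfolding run.decision_def[abs_def] run.state_def gossip_decisions_def[abs_def] .
  qed
  with xs nash_unique show ?thesis
    by blast
qed

end
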